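(* Let $R\subseteq \mathrm{GL}_n(\mathbb{R})$ be a finite reflection group with a fixed ordered basis of $\mathbb{R}^n$ and corresponding set of simple reflections $S_\Delta$, let $k\geq 1$, let $S_0,S_1,\ldots,S_k\subseteq S_\Delta$, and let $G$ be the $(S_0;S_1,\ldots,S_k;S_\Delta)$-left-reflection bigraph. Then $G$ is left-cut-percolating under the set of its reflection folds.
   Context: A bigraph is a triple $G=(V_1,V_2,E)$ with $V_1,V_2$ disjoint finite sets and $E\subseteq V_1\times V_2$; write $V_i(G)=V_i$, $E(G)=E$, $V(G)=V_1\cup V_2$. An automorphism of $G$ is a bijection of $V(G)$ preserving $V_1(G)$, $V_2(G)$, edges and non-edges. For $U\subseteq V(G)$, $G|_U$ is the induced subgraph and $G-U=G|_{V(G)\setminus U}$. Folds. A cut-involution of $G$ is an automorphism $\phi$ of $G$ with $\phi=\phi^{-1}$ such that, with $\mathrm{Fix}(\phi)$ the set of vertices fixed by $\phi$, the bigraph $G-\mathrm{Fix}(\phi)$ is disconnected. A fold of $G$ is a pair $(\phi,L)$ where $\phi$ is a cut-involution of $G$ and $L\subseteq V(G)$ is such that $G|_L$ is a union of connected components of $G-\mathrm{Fix}(\phi)$ and $(L,\mathrm{Fix}(\phi),\phi(L))$ is a partition of $V(G)$. Its left-folding map $\phi_L: V(G)\to V(G)$ is $\phi_L(v)=\phi(v)$ if $v\notin L$ and $\phi_L(v)=v$ if $v\in L$. Left-cut-percolation. For a set $S$ of folds of $G$, $G$ is left-cut-percolating under $S$ if there are $m\geq 0$ and sets $U_0,U_1,\ldots,U_m\subseteq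 V_1(G)$ with $|U_0|=1$, $U_m=V_1(G)$ and, for every $i\in\{1,\ldots,m\}$, a fold $(\phi_i,L_i)\in S$ with $U_i=(\phi_i)_{L_i}^{-1}(U_{i-1})$. Reflection groups. Let $R\subseteq \mathrm{GL}_n(\mathbb{R})$ be a finite group generated by (orthogonal) reflections and let $T\subseteq R$ be the set of reflections in $R$. The root system $\Phi$ is the set of unit vectors orthogonal to some hyperplane fixed by an element of $T$. Given an ordered basis $(u_1,\ldots,u_n)$ of $\mathbb{R}^n$, a root $\alpha=\sum_i c_iu_i$ is positive if $c_{i_0}>0$ for the first index $i_0$ with $c_{i_0}\neq 0$; $\Phi^+$ is the set of positive roots. For $\alpha\in\Phi$, $H_\alpha$ is the hyperplane orthogonal to $\alpha$, $s_\alpha\in T$ is the reflection on $H_\alpha$, and $D_\alpha^+=\{x\in\mathbb{R}^n: \langle x,\alpha\rangle>0\}$. For $t\in T$, $\alpha_t\in\Phi^+$ is the unique positive root with $s_{\alpha_t}=t$, and $H_t=H_{\alpha_t}$, $D_t^+=D_{\alpha_t}^+$. The simple system $\Delta\subseteq\Phi^+$ is the (unique) minimal subset of $\Phi^+$ such that every positive root is a linear combination with non-negative coefficients of elements of $\Delta$; the set of simple reflections is $S_\Delta=\{s_\alpha:\alpha\in\Delta\}$, which generates $R$. For $I\subseteq S_\Delta$, let $C(I)=\left(\bigcap_{s\in I}H_s\right)\cap\left(\bigcap_{s\in S_\Delta\setminus I}D_s^+\right)$. Left-reflection bigraphs. For $S_0,S_1,\ldots,S_k\subseteq S_\Delta$,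 let $R_i$ be the subgroup of $R$ generated by $S_i$. The $(S_0;S_1,\ldots,S_k;S_\Delta)$-left-reflection bigraph $G$ is given by $V_1(G)=R/R_0=\{rR_0: r\in R\}$ (left cosets), $V_2(G)=\{(rR_i,i): r\in R, 1\leq i\leq k\}$, $E(G)=\{(rR_0,(rR_i,i)): r\in R, 1\leq i\leq k\}$. A reflection fold of $G$ is a fold of $G$ of the form $(\phi^t,L^t)$ with $t\in T$, where $\phi^t(rR_0)=trR_0$, $\phi^t((rR_i,i))=(trR_i,i)$, and $L^t=\{rR_0: r(C(S_0))\subseteq D_{\alpha_t}^+\}\cup\bigcup_{i=1}^k\{(rR_i,i): r(C(S_i))\subseteq D_{\alpha_t}^+\}$. *)

theory Defs
  imports "HOL-Analysis.Analysis" "HOL-Algebra.Generated_Groups"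
begin

section \<open>Bigraphs, folds and left-cut-percolation\<close>

record 'v bigraph =
  V1 :: "'v set"
  V2 :: "'v set"
  edges :: "('v \<times> 'v) set"

definition wf_bigraph :: "'v bigraph \<Rightarrow> bool" where
  "wf_bigraph G \<longleftrightarrow> finite (V1 G) \<and> finite (V2 G) \<and> V1 G \<inter> V2 G = {} \<and> edges G \<subseteq> V1 G \<times> V2 G"

definition verts :: "'v bigraph \<Rightarrow> 'v set" where
  "verts G = V1 G \<union> V2 G"

definition induced :: "'v bigraph \<Rightarrow> 'v set \<Rightarrow> 'v bigraph" where
  "induced G U = \<lparr>V1 = V1 G \<inter> U, V2 = V2 G \<inter> U, edges = edges G \<inter> U \<times> U\<rparr>"

definition delete :: "'v bigraph \<Rightarrow> 'v set \<Rightarrow> 'v bigraph" where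
  "delete G U = induced G (verts G - U)"

definition linked :: "'v bigraph \<Rightarrow> ('v \<times> 'v) set" where
  "linked G = {(u, v). u \<in> verts G \<and> v \<in> verts G \<and> (u, v) \<in> (edges G \<union> (edges G)\<inverse>)\<^sup>*}"

definition conn_components :: "'v bigraph \<Rightarrow> 'v set set" where
  "conn_components G = verts G // linked G"

text \<open>The bigraph without vertices does not count as disconnected.\<close>

definition disconnected :: "'v bigraph \<Rightarrow> bool" where
  "disconnected G \<longleftrightarrow> (\<exists>C\<in>conn_components G. \<exists>D\<in>conn_components G. C \<noteq> D)"

text \<open>Maps on vertices are total functions on the type; their values outside \<open>verts G\<close> play no role.\<close>

definition automorphism :: "'v bigraph \<Rightarrow> ('v \<Rightarrow> 'v) \<Rightarrow> bool" where
  "automorphism G \<phi> \<longleftrightarrow>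
     bij_betw \<phi> (verts G) (verts G) \<and> \<phi> ` V1 G = V1 G \<and> \<phi> ` V2 G = V2 G \<and>
     (\<forall>u\<in>V1 G. \<forall>v\<in>V2 G. (\<phi> u, \<phi> v) \<in> edges G \<longleftrightarrow> (u, v) \<in> edges G)"

definition Fix :: "'v bigraph \<Rightarrow> ('v \<Rightarrow> 'v) \<Rightarrow> 'v set" where
  "Fix G \<phi> = {v \<in> verts G. \<phi> v = v}"

definition cut_involution :: "'v bigraph \<Rightarrow> ('v \<Rightarrow> 'v) \<Rightarrow> bool" where
  "cut_involution G \<phi> \<longleftrightarrow>
     automorphism G \<phi> \<and> (\<forall>v\<in>verts G. \<phi> (\<phi> v) = v) \<and> disconnected (delete G (Fix G \<phi>))"

text \<open>The parts of the partition may be empty: \<open>\<phi>\<close> need not have fixed vertices.\<close>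

definition folds :: "'v bigraph \<Rightarrow> (('v \<Rightarrow> 'v) \<times> 'v set) set" where
  "folds G = {(\<phi>, L). cut_involution G \<phi> \<and> L \<subseteq> verts G \<and>
     (\<exists>\<C> \<subseteq> conn_components (delete G (Fix G \<phi>)). L = \<Union>\<C>) \<and>
     L \<union> Fix G \<phi> \<union> \<phi> ` L = verts G \<and>
     L \<inter> Fix G \<phi> = {} \<and> L \<inter> \<phi> ` L = {} \<and> Fix G \<phi> \<inter> \<phi> ` L = {}}"

definition left_folding :: "('v \<Rightarrow> 'v) \<Rightarrow> 'v set \<Rightarrow> 'v \<Rightarrow> 'v" where
  "left_folding \<phi> L v = (if v \<in> L then v else \<phi> v)"

definition left_cut_percolating :: "'v bigraph \<Rightarrow> (('v \<Rightarrow> 'v) \<times> 'v set) set \<Rightarrow> bool" where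
  "left_cut_percolating G S \<longleftrightarrow>
     (\<exists>(m::nat) U. (\<forall>i\<le>m. U i \<subseteq> V1 G) \<and> card (U 0) = 1 \<and> U m = V1 G \<and>
        (\<forall>i\<in>{1..m}. \<exists>(\<phi>, L)\<in>S. U i = {v \<in> verts G. left_folding \<phi> L v \<in> U (i - 1)}))"

section \<open>Finite reflection groups\<close>

definition GL :: "(real^'n^'n) monoid" where
  "GL = \<lparr>carrier = {A. invertible A}, monoid.mult = (**), one = mat 1\<rparr>"

definition hyperplane :: "real^'n \<Rightarrow> (real^'n) set" where
  "hyperplane \<alpha> = {x. x \<bullet> \<alpha> = 0}"

definition pos_side :: "real^'n \<Rightarrow> (real^'n) set" where
  "pos_side \<alpha> = {x. x \<bullet> \<alpha> > 0}"

definition refl_mat :: "real^'n \<Rightarrow> real^'n^'n" where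
  "refl_mat \<alpha> = matrix (\<lambda>x. x - (2 * (x \<bullet> \<alpha>) / (\<alpha> \<bullet> \<alpha>)) *\<^sub>R \<alpha>)"

definition reflections :: "(real^'n^'n) set \<Rightarrow> (real^'n^'n) set" where
  "reflections R = {t \<in> R. \<exists>\<alpha>. \<alpha> \<noteq> 0 \<and> t = refl_mat \<alpha>}"

definition finite_reflection_group :: "(real^'n^'n) set \<Rightarrow> bool" where
  "finite_reflection_group R \<longleftrightarrow>
     subgroup R GL \<and> finite R \<and> (\<exists>A \<subseteq> reflections R. R = generate GL A)"

text \<open>The hyperplane fixed (pointwise) by a reflection \<open>t\<close> is \<open>{x. t *v x = x}\<close>.\<close>

definition roots :: "(real^'n^'n) set \<Rightarrow> (real^'n) set" where
  "roots R = {\<alpha>. norm \<alpha> = 1 \<and> (\<exists>t\<in>reflections R. \<forall>x. t *v x = x \<longrightarrow> orthogonal \<alpha> x)}"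

definition ordered_basis :: "(real^'n) list \<Rightarrow> bool" where
  "ordered_basis us \<longleftrightarrow> distinct us \<and> independent (set us) \<and> span (set us) = UNIV"

definition positive_roots :: "(real^'n^'n) set \<Rightarrow> (real^'n) list \<Rightarrow> (real^'n) set" where
  "positive_roots R us = {\<alpha> \<in> roots R. \<exists>c. \<alpha> = (\<Sum>i<length us. c i *\<^sub>R us ! i) \<and>
     (\<exists>i<length us. c i > 0 \<and> (\<forall>j<i. c j = 0))}"

definition nonneg_spanning :: "(real^'n) set \<Rightarrow> (real^'n) set \<Rightarrow> bool" where
  "nonneg_spanning B P \<longleftrightarrow>
     (\<forall>\<beta>\<in>P. \<exists>c. (\<forall>\<alpha>\<in>B. c \<alpha> \<ge> 0) \<and> \<beta> = (\<Sum>\<alpha>\<in>B. c \<alpha> *\<^sub>R \<alpha>))"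

definition simple_system :: "(real^'n^'n) set \<Rightarrow> (real^'n) list \<Rightarrow> (real^'n) set \<Rightarrow> bool" where
  "simple_system R us \<Delta> \<longleftrightarrow>
     \<Delta> \<subseteq> positive_roots R us \<and> nonneg_spanning \<Delta> (positive_roots R us) \<and>
     (\<forall>B. B \<subset> \<Delta> \<longrightarrow> \<not> nonneg_spanning B (positive_roots R us))"

definition root_of :: "(real^'n^'n) set \<Rightarrow> (real^'n) list \<Rightarrow> real^'n^'n \<Rightarrow> real^'n" where
  "root_of R us t = (THE \<alpha>. \<alpha> \<in> positive_roots R us \<and> refl_mat \<alpha> = t)"

definition simple_reflections :: "(real^'n) set \<Rightarrow> (real^'n^'n) set" where
  "simple_reflections \<Delta> = refl_mat ` \<Delta>"

text \<open>The cone \<open>C(I)\<close>; an empty intersection is the whole space.\<close>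

definition face ::
  "(real^'n^'n) set \<Rightarrow> (real^'n) list \<Rightarrow> (real^'n) set \<Rightarrow> (real^'n^'n) set \<Rightarrow> (real^'n) set" where
  "face R us \<Delta> I =
     (\<Inter>s\<in>I. hyperplane (root_of R us s)) \<inter>
     (\<Inter>s\<in>simple_reflections \<Delta> - I. pos_side (root_of R us s))"

section \<open>Left-reflection bigraphs\<close>

text \<open>The family \<open>S\<close> carries \<open>S\<^sub>0\<close> at index \<open>0\<close> and \<open>S\<^sub>1, \<dots>, S\<^sub>k\<close> at the indices \<open>1, \<dots>, k\<close>;
  values at larger indices are irrelevant. The subgroup \<open>R\<^sub>i\<close> is \<open>generate GL (S i)\<close>.\<close>

type_synonym 'n refl_vertex = "(real^'n^'n) set + (real^'n^'n) set \<times> nat"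

definition left_reflection_bigraph ::
  "(real^'n^'n) set \<Rightarrow> nat \<Rightarrow> (nat \<Rightarrow> (real^'n^'n) set) \<Rightarrow> 'n refl_vertex bigraph" where
  "left_reflection_bigraph R k S =
     \<lparr>V1 = {Inl (r <#\<^bsub>GL\<^esub> generate GL (S 0)) | r. r \<in> R},
      V2 = {Inr (r <#\<^bsub>GL\<^esub> generate GL (S i), i) | r i. r \<in> R \<and> 1 \<le> i \<and> i \<le> k},
      edges = {(Inl (r <#\<^bsub>GL\<^esub> generate GL (S 0)), Inr (r <#\<^bsub>GL\<^esub> generate GL (S i), i)) | r i.
                 r \<in> R \<and> 1 \<le> i \<and> i \<le> k}\<rparr>"

text \<open>On cosets, \<open>X \<mapsto> t X\<close> sends \<open>r R\<^sub>i\<close> to \<open>(t r) R\<^sub>i\<close>; see \<open>refl_map_coset\<close> below.\<close>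

definition refl_map :: "real^'n^'n \<Rightarrow> 'n refl_vertex \<Rightarrow> 'n refl_vertex" where
  "refl_map t = map_sum (\<lambda>X. t <#\<^bsub>GL\<^esub> X) (\<lambda>(X, i). (t <#\<^bsub>GL\<^esub> X, i))"

definition refl_left ::
  "(real^'n^'n) set \<Rightarrow> (real^'n) list \<Rightarrow> (real^'n) set \<Rightarrow> nat \<Rightarrow> (nat \<Rightarrow> (real^'n^'n) set)
    \<Rightarrow> real^'n^'n \<Rightarrow> 'n refl_vertex set" where
  "refl_left R us \<Delta> k S t =
     {Inl (r <#\<^bsub>GL\<^esub> generate GL (S 0)) | r.
        r \<in> R \<and> (*v) r ` face R us \<Delta> (S 0) \<subseteq> pos_side (root_of R us t)} \<union>
     {Inr (r <#\<^bsub>GL\<^esub> generate GL (S i), i) | r i.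
        r \<in> R \<and> 1 \<le> i \<and> i \<le> k \<and> (*v) r ` face R us \<Delta> (S i) \<subseteq> pos_side (root_of R us t)}"

definition reflection_folds ::
  "(real^'n^'n) set \<Rightarrow> (real^'n) list \<Rightarrow> (real^'n) set \<Rightarrow> nat \<Rightarrow> (nat \<Rightarrow> (real^'n^'n) set)
    \<Rightarrow> (('n refl_vertex \<Rightarrow> 'n refl_vertex) \<times> 'n refl_vertex set) set" where
  "reflection_folds R us \<Delta> k S =
     {(refl_map t, refl_left R us \<Delta> k S t) | t. t \<in> reflections R} \<inter>
     folds (left_reflection_bigraph R k S)"

section \<open>Consistency of the definitions\<close>

lemma group_GL: "group GL"
proof (rule groupI)
  fix x :: "real^'n^'n" assume "x \<in> carrier GL"
  then obtain y where "x ** y = mat 1" "y ** x = mat 1"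
    by (auto simp: GL_def invertible_def)
  then show "\<exists>y\<in>carrier GL. y \<otimes>\<^bsub>GL\<^esub> x = \<one>\<^bsub>GL\<^esub>"
    by (auto simp: GL_def invertible_def)
next
  show "\<one>\<^bsub>GL\<^esub> \<in> carrier GL"
    by (auto simp: GL_def invertible_def intro!: exI[of _ "mat 1"])
qed (auto simp: GL_def invertible_mult matrix_mul_assoc)

lemma refl_mat_mult:
  fixes b x :: "real^'n"
  shows "refl_mat b *v x = x - (2 * (x \<bullet> b) / (b \<bullet> b)) *\<^sub>R b"
proof -
  have "linear (\<lambda>x. x - (2 * (x \<bullet> b) / (b \<bullet> b)) *\<^sub>R b)"
  proof (rule linearI)
    fix x y :: "real^'n" and r :: real
    have "2 * ((x + y) \<bullet> b) / (b \<bullet> b) = 2 * (x \<bullet> b) / (b \<bullet> b) + 2 * (y \<bullet> b) / (b \<bullet> b)"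
      unfolding inner_add_left distrib_left add_divide_distrib ..
    then show "x + y - (2 * ((x + y) \<bullet> b) / (b \<bullet> b)) *\<^sub>R b =
        x - (2 * (x \<bullet> b) / (b \<bullet> b)) *\<^sub>R b + (y - (2 * (y \<bullet> b) / (b \<bullet> b)) *\<^sub>R b)"
      by (simp only: scaleR_add_left) simp
    have "2 * ((r *\<^sub>R x) \<bullet> b) / (b \<bullet> b) = r * (2 * (x \<bullet> b) / (b \<bullet> b))"
      unfolding inner_scaleR_left by (simp only: times_divide_eq_right mult.left_commute)
    then show "r *\<^sub>R x - (2 * ((r *\<^sub>R x) \<bullet> b) / (b \<bullet> b)) *\<^sub>R b =
        r *\<^sub>R (x - (2 * (x \<bullet> b) / (b \<bullet> b)) *\<^sub>R b)"
      by (simp only: scaleR_diff_right scaleR_scaleR)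
  qed
  then show ?thesis
    unfolding refl_mat_def by (subst matrix_works) (simp_all add: linear_matrix_vector_mul_eq)
qed

lemma root_multiple:
  assumes b: "b \<noteq> 0" and t: "\<And>x. refl_mat b *v x = x \<Longrightarrow> orthogonal \<alpha> x"
  obtains c where "\<alpha> = c *\<^sub>R b"
proof -
  define c where "c = (\<alpha> \<bullet> b) / (b \<bullet> b)"
  define w where "w = \<alpha> - c *\<^sub>R b"
  have wb: "w \<bullet> b = 0" 
    unfolding w_def inner_diff_left inner_scaleR_left c_def using b by simp
  then have "\<alpha> \<bullet> w = 0" using t[of w] by (simp add: refl_mat_mult orthogonal_def)
  then have "w \<bullet> w = 0" using wb
    by (metis diff_zero inner_commute inner_diff_left inner_scaleR_left mult_zero_right w_def)
  then show ?thesis using that[of c] by (simp add: w_def)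
qed

lemma finite_roots:
  assumes "finite R"
  shows "finite (roots R)"
proof -
  have *: "finite {\<alpha>. norm \<alpha> = 1 \<and> (\<forall>x. t *v x = x \<longrightarrow> orthogonal \<alpha> x)}"
    if "t \<in> reflections R" for t
  proof -
    obtain b where b: "b \<noteq> 0" "t = refl_mat b" using \<open>t \<in> reflections R\<close> by (auto simp: reflections_def)
    have "{\<alpha>. norm \<alpha> = 1 \<and> (\<forall>x. t *v x = x \<longrightarrow> orthogonal \<alpha> x)} \<subseteq>
       {(1 / norm b) *\<^sub>R b, (- (1 / norm b)) *\<^sub>R b}"
    proof
      fix \<alpha> assume a: "\<alpha> \<in> {\<alpha>. norm \<alpha> = 1 \<and> (\<forall>x. t *v x = x \<longrightarrow> orthogonal \<alpha> x)}"
      then obtain c where c: "\<alpha> = c *\<^sub>R b" using root_multiple[OF b(1)] b(2) by auto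
      with a b(1) have "\<bar>c\<bar> = 1 / norm b" by (simp add: field_simps)
      then have "c = 1 / norm b \<or> c = - (1 / norm b)" by linarith
      then show "\<alpha> \<in> {(1 / norm b) *\<^sub>R b, (- (1 / norm b)) *\<^sub>R b}" using c by auto
    qed
    then show ?thesis by (rule finite_subset) simp
  qed
  have fin: "finite (reflections R)" using assms by (simp add: reflections_def)
  have eq: "roots R = (\<Union>t\<in>reflections R. {\<alpha>. norm \<alpha> = 1 \<and> (\<forall>x. t *v x = x \<longrightarrow> orthogonal \<alpha> x)})"
    by (auto simp: roots_def)
  show ?thesis unfolding eq by (rule finite_UN_I[OF fin *])
qed

lemma refl_mat_root:
  assumes "\<alpha> \<in> roots R"
  shows "refl_mat \<alpha> \<in> reflections R"
proof -
  obtain t b where t: "t \<in> reflections R" "t = refl_mat b" "b \<noteq> 0"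
     "\<And>x. t *v x = x \<Longrightarrow> orthogonal \<alpha> x" and n: "norm \<alpha> = 1"
    using assms by (auto simp: roots_def reflections_def)
  obtain c where ac: "\<alpha> = c *\<^sub>R b"
    using root_multiple[OF t(3)] t(2,4) by blast
  with n have "c \<noteq> 0" by auto
  have "(2 * (x \<bullet> \<alpha>) / (\<alpha> \<bullet> \<alpha>)) *\<^sub>R \<alpha> = (2 * (x \<bullet> b) / (b \<bullet> b)) *\<^sub>R b" for x
    using \<open>c \<noteq> 0\<close> by (simp add: ac)
  then have "refl_mat \<alpha> = refl_mat b"
    by (simp add: refl_mat_def)
  then show ?thesis using t by simp
qed

lemma simple_reflections_subset:
  "simple_system R us \<Delta> \<Longrightarrow> simple_reflections \<Delta> \<subseteq> reflections R"
  by (auto simp: simple_reflections_def simple_system_def positive_roots_def intro: refl_mat_root)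

lemma simple_system_exists:
  assumes "finite R"
  shows "\<exists>\<Delta>. simple_system R us \<Delta>"
proof -
  let ?P = "positive_roots R us"
  have fin: "finite ?P" using finite_roots[OF assms] by (auto simp: positive_roots_def)
  have "nonneg_spanning ?P ?P"
    unfolding nonneg_spanning_def
  proof
    fix \<beta> assume "\<beta> \<in> ?P"
    then have "\<beta> = (\<Sum>\<alpha>\<in>?P. (if \<alpha> = \<beta> then 1 else 0) *\<^sub>R \<alpha>)"
      using fin by (simp add: if_distrib[of "\<lambda>c. c *\<^sub>R _"] cong: if_cong)
    then show "\<exists>c. (\<forall>\<alpha>\<in>?P. c \<alpha> \<ge> 0) \<and> \<beta> = (\<Sum>\<alpha>\<in>?P. c \<alpha> *\<^sub>R \<alpha>)"
      by (intro exI[of _ "\<lambda>\<alpha>. if \<alpha> = \<beta> then 1 else 0"]) simp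
  qed
  then have ne: "{B. B \<subseteq> ?P \<and> nonneg_spanning B ?P} \<noteq> {}" by blast
  have "finite {B. B \<subseteq> ?P \<and> nonneg_spanning B ?P}" using fin by simp
  from finite_has_minimal[OF this ne] obtain \<Delta> where
    D: "\<Delta> \<subseteq> ?P" "nonneg_spanning \<Delta> ?P"
      "\<forall>B\<in>{B. B \<subseteq> ?P \<and> nonneg_spanning B ?P}. B \<subseteq> \<Delta> \<longrightarrow> \<Delta> = B"
    by auto
  have "simple_system R us \<Delta>"
    unfolding simple_system_def using D by blast
  then show ?thesis ..
qed

lemma refl_map_coset:
  "t <#\<^bsub>GL\<^esub> (r <#\<^bsub>GL\<^esub> H) = (t ** r) <#\<^bsub>GL\<^esub> H"
  by (auto simp: l_coset_def GL_def matrix_mul_assoc)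

lemma wf_left_reflection_bigraph:
  assumes "finite R"
  shows "wf_bigraph (left_reflection_bigraph R k S)"
proof -
  have "{Inr (r <#\<^bsub>GL\<^esub> generate GL (S i), i) | r i. r \<in> R \<and> 1 \<le> i \<and> i \<le> k} =
     (\<lambda>(r, i). Inr (r <#\<^bsub>GL\<^esub> generate GL (S i), i) :: 'a refl_vertex) ` (R \<times> {1..k})"
    by force
  then show ?thesis
    using assms by (auto simp: wf_bigraph_def left_reflection_bigraph_def)
qed

end

theory Submission
  imports Defs
begin

text \<open>Choose \<open>x\<^sub>i \<in> C(S\<^sub>i)\<close>. The closed fundamental chamber is a strict fundamental domain and the
  stabilizer of \<open>x\<^sub>i\<close> is \<open>R\<^sub>i\<close>, so the vertex \<open>rR\<^sub>i\<close> is faithfully represented by the point \<open>r x\<^sub>i\<close>: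
  for a positive root \<open>\<alpha>\<close>, the reflection \<open>s\<^sub>\<alpha>\<close> fixes or moves the vertex according to whether
  \<open>\<langle>r x\<^sub>i, \<alpha>\<rangle>\<close> vanishes, and the sign of this number decides the side. Endpoints of an edge lie in a
  common closed chamber, hence never on opposite sides; so \<open>s\<^sub>\<alpha>\<close> gives a fold as soon as it moves a vertex.
  Left-folding never decreases \<open>\<langle>\<rho>, r x\<^sub>0\<rangle>\<close>, where \<open>\<rho>\<close> has inner product 1 with every simple root, and
  some simple reflection increases it strictly unless \<open>r x\<^sub>0\<close> is dominant, that is \<open>rR\<^sub>0 = R\<^sub>0\<close>.
  Thus a composite of left-foldings sends every coset to \<open>R\<^sub>0\<close>.\<close>


section \<open>Reflection matrices and words\<close>

lemma refl_mat_self [simp]: "refl_mat a *v a = - a"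
proof (cases "a = 0")
  case False
  then show ?thesis by (simp add: refl_mat_mult scaleR_2)
qed (simp add: refl_mat_mult)

lemma refl_mat_involutive [simp]:
  fixes a :: "real^'n"
  shows "refl_mat a ** refl_mat a = mat 1"
proof -
  have "refl_mat a *v (refl_mat a *v x) = x" for x :: "real^'n"
  proof -
    have "refl_mat a *v (refl_mat a *v x) =
        refl_mat a *v x - (2 * (x \<bullet> a) / (a \<bullet> a)) *\<^sub>R (refl_mat a *v a)"
      by (subst refl_mat_mult[of a x])
        (simp add: matrix_vector_mult_diff_distrib matrix_vector_mult_scaleR)
    also have "\<dots> = x" unfolding refl_mat_self by (simp add: refl_mat_mult)
    finally show ?thesis .
  qed
  then show ?thesis
    by (simp add: matrix_eq flip: matrix_vector_mul_assoc)
qed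

lemma refl_mat_inner: "(refl_mat a *v x) \<bullet> y = x \<bullet> (refl_mat a *v y)"
  by (simp add: refl_mat_mult inner_diff_left inner_diff_right inner_commute)

lemma transpose_refl_mat [simp]:
  fixes a :: "real^'n"
  shows "transpose (refl_mat a) = refl_mat a"
proof -
  have "(transpose (refl_mat a) *v x) \<bullet> y = (refl_mat a *v x) \<bullet> y" for x y :: "real^'n"
    unfolding transpose_matrix_vector dot_lmul_matrix refl_mat_inner ..
  then show ?thesis
    by (simp add: matrix_eq) (metis vector_eq_rdot)
qed

lemma orthogonal_matrix_refl_mat: "orthogonal_matrix (refl_mat a)"
  by (simp add: orthogonal_matrix)

lemma inner_transpose: "(A *v x) \<bullet> y = x \<bullet> (transpose A *v y)" for A :: "real^'n^'n"
  by (metis dot_lmul_matrix transpose_matrix_vector inner_commute)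

lemma orthogonal_matrix_inner:
  "orthogonal_matrix A \<Longrightarrow> (A *v x) \<bullet> (A *v y) = x \<bullet> y" for A :: "real^'n^'n"
  by (simp add: inner_transpose matrix_vector_mul_assoc orthogonal_matrix)

text \<open>Conjugating a reflection by an orthogonal matrix gives the reflection in the image
  vector; it is stated in multiplied-out form so that no inverse occurs.\<close>

lemma refl_mat_conj:
  assumes "orthogonal_matrix A"
  shows "refl_mat (A *v a) ** A = A ** refl_mat a"
  using assms
  by (simp add: matrix_eq refl_mat_mult orthogonal_matrix_inner matrix_vector_mult_diff_distrib
      matrix_vector_mult_scaleR flip: matrix_vector_mul_assoc)

text \<open>Words are kept as lists of vectors, so that inductions can use their length and inspect
  or delete single letters.\<close>

definition wprod :: "(real^'n) list \<Rightarrow> real^'n^'n" where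
  "wprod as = foldr (\<lambda>a w. refl_mat a ** w) as (mat 1)"

lemma wprod_Nil [simp]: "wprod [] = mat 1"
  and wprod_Cons [simp]: "wprod (a # as) = refl_mat a ** wprod as"
  by (simp_all add: wprod_def)

lemma wprod_append [simp]: "wprod (as @ bs) = wprod as ** wprod bs"
  by (induction as) (simp_all add: matrix_mul_assoc)

lemma transpose_wprod: "transpose (wprod as) = wprod (rev as)"
  by (induction as) (simp_all add: matrix_transpose_mul transpose_mat)

lemma orthogonal_matrix_wprod: "orthogonal_matrix (wprod as)"
  by (induction as) (simp_all add: orthogonal_matrix_id orthogonal_matrix_mul orthogonal_matrix_refl_mat)

lemma invertible_refl_mat: "invertible (refl_mat a)"
  unfolding invertible_def using refl_mat_involutive by blast

lemma inv_refl_mat: "inv\<^bsub>GL\<^esub> refl_mat a = refl_mat a"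
  by (rule group.inv_equality[OF group_GL]) (simp_all add: GL_def invertible_refl_mat)

text \<open>Reflections are their own inverses, so closing under inverses adds no letters and words
  exhaust the generated subgroup.\<close>

lemma generate_refl_mat: "generate GL (refl_mat ` A) = wprod ` lists A"
proof (intro equalityI subsetI)
  fix w assume "w \<in> generate GL (refl_mat ` A)"
  then show "w \<in> wprod ` lists A"
  proof (induction rule: generate.induct)
    case one
    show ?case by (rule image_eqI[of _ _ "[]"]) (auto simp: GL_def)
  next
    case (incl h)
    then obtain a where "a \<in> A" "h = refl_mat a" by auto
    then show ?case by (intro image_eqI[of _ _ "[a]"]) auto
  next
    case (inv h)
    then obtain a where "a \<in> A" "h = refl_mat a" by auto
    then show ?case by (intro image_eqI[of _ _ "[a]"]) (auto simp: inv_refl_mat)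
  next
    case (eng h1 h2)
    then obtain as bs where "as \<in> lists A" "bs \<in> lists A" "h1 = wprod as" "h2 = wprod bs" by auto
    then show ?case by (intro image_eqI[of _ _ "as @ bs"]) (auto simp: GL_def)
  qed
next
  fix w assume "w \<in> wprod ` lists A"
  then obtain as where "as \<in> lists A" "w = wprod as" by auto
  then show "w \<in> generate GL (refl_mat ` A)"
  proof (induction as arbitrary: w)
    case Nil
    then show ?case using generate.one[of GL] by (simp add: GL_def)
  next
    case (Cons a as)
    then have "refl_mat a \<otimes>\<^bsub>GL\<^esub> wprod as \<in> generate GL (refl_mat ` A)"
      by (intro generate.eng generate.incl Cons.IH) auto
    then show ?case using Cons by (simp add: GL_def)
  qed
qed

section \<open>Lexicographic positivity\<close>

text \<open>The positivity clause of \<open>positive_roots\<close>, detached from roots so that it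
  also applies to sums and multiples of roots.\<close>

definition lex_pos :: "(real^'n) list \<Rightarrow> real^'n \<Rightarrow> bool" where
  "lex_pos us v \<longleftrightarrow> (\<exists>c. v = (\<Sum>i<length us. c i *\<^sub>R us ! i) \<and>
     (\<exists>i<length us. c i > 0 \<and> (\<forall>j<i. c j = 0)))"

text \<open>The leading index of the sum is the smaller of the two leading indices; no cancellation
  can occur there.\<close>

lemma lex_pos_add:
  assumes "lex_pos us v" "lex_pos us w"
  shows "lex_pos us (v + w)"
proof -
  obtain c i where c: "v = (\<Sum>i<length us. c i *\<^sub>R us ! i)" "i < length us" "c i > 0" "\<forall>j<i. c j = 0"
    using assms(1) unfolding lex_pos_def by blast
  obtain d k where d: "w = (\<Sum>i<length us. d i *\<^sub>R us ! i)" "k < length us" "d k > 0" "\<forall>j<k. d j = 0"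
    using assms(2) unfolding lex_pos_def by blast
  have "v + w = (\<Sum>i<length us. (c i + d i) *\<^sub>R us ! i)"
    by (simp add: c(1) d(1) sum.distrib scaleR_add_left)
  moreover have "c (min i k) + d (min i k) > 0"
    using c d by (cases i k rule: linorder_cases) (auto simp: min_def)
  moreover have "\<forall>j<min i k. c j + d j = 0" using c d by simp
  ultimately show ?thesis unfolding lex_pos_def using c(2)
    by (intro exI[of _ "\<lambda>i. c i + d i"] conjI exI[of _ "min i k"]) auto
qed

lemma lex_pos_scaleR:
  assumes "lex_pos us v" "r > 0"
  shows "lex_pos us (r *\<^sub>R v)"
proof -
  obtain c i where "v = (\<Sum>i<length us. c i *\<^sub>R us ! i)" "i < length us" "c i > 0" "\<forall>j<i. c j = 0"
    using assms(1) unfolding lex_pos_def by blast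
  then show ?thesis unfolding lex_pos_def using assms(2)
    by (intro exI[of _ "\<lambda>i. r * c i"] conjI exI[of _ i]) (auto simp: scaleR_sum_right)
qed

lemma lex_pos_cases:
  assumes "ordered_basis us" "v \<noteq> 0"
  shows "lex_pos us v \<or> lex_pos us (- v)"
proof -
  have bij: "bij_betw ((!) us) {..<length us} (set us)"
    using assms(1) by (auto simp: ordered_basis_def intro: bij_betw_nth)
  have "v \<in> span (set us)" using assms(1) by (simp add: ordered_basis_def)
  then obtain u where "v = (\<Sum>a\<in>set us. u a *\<^sub>R a)"
    by (auto simp: span_finite)
  then have v: "v = (\<Sum>i<length us. u (us ! i) *\<^sub>R us ! i)"
    by (simp add: sum.reindex_bij_betw[OF bij, of "\<lambda>a. u a *\<^sub>R a"])
  define P where "P i \<longleftrightarrow> i < length us \<and> u (us ! i) \<noteq> 0" for i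
  have "\<exists>i. P i"
  proof (rule ccontr)
    assume "\<nexists>i. P i"
    then have "v = 0" unfolding v by (intro sum.neutral) (auto simp: P_def)
    then show False using assms(2) by simp
  qed
  then obtain i where "P i" "\<forall>j<i. \<not> P j"
    by (metis exists_least_iff)
  then have i: "i < length us" "u (us ! i) \<noteq> 0" "\<forall>j<i. u (us ! j) = 0"
    by (auto simp: P_def)
  show ?thesis
  proof (cases "u (us ! i) > 0")
    case True
    then have "lex_pos us v" using v i unfolding lex_pos_def
      by (intro exI[of _ "\<lambda>i. u (us ! i)"] conjI exI[of _ i]) auto
    then show ?thesis ..
  next
    case False
    have "- v = (\<Sum>i<length us. (- u (us ! i)) *\<^sub>R us ! i)"
      by (subst v) (simp add: sum_negf)
    then have "lex_pos us (- v)" using i False unfolding lex_pos_def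
      by (intro exI[of _ "\<lambda>i. - u (us ! i)"] conjI exI[of _ i]) auto
    then show ?thesis ..
  qed
qed

lemma not_lex_pos_0:
  assumes "ordered_basis us"
  shows "\<not> lex_pos us 0"
proof
  have bij: "bij_betw ((!) us) {..<length us} (set us)"
    using assms(1) by (auto simp: ordered_basis_def intro: bij_betw_nth)
  assume "lex_pos us 0"
  then obtain c i where c: "0 = (\<Sum>i<length us. c i *\<^sub>R us ! i)" "i < length us" "c i > 0"
    unfolding lex_pos_def by blast
  \<comment> \<open>Independence speaks of coefficients indexed by vectors, so positions in
    \<open>us\<close> have to be recovered from the vectors.\<close>
  define g where "g = the_inv_into {..<length us} ((!) us)"
  have g: "g (us ! j) = j" if "j < length us" for j
    unfolding g_def using bij that by (intro the_inv_into_f_f) (auto simp: bij_betw_def)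
  have "(\<Sum>a\<in>set us. c (g a) *\<^sub>R a) = 0"
    using c(1) by (simp add: g flip: sum.reindex_bij_betw[OF bij])
  then have "c (g (us ! i)) = 0"
    using assms c(2) independentD[of "set us" "set us" "\<lambda>a. c (g a)" "us ! i"]
    by (simp add: ordered_basis_def)
  then show False using c g by simp
qed

lemma lex_pos_uminus: "ordered_basis us \<Longrightarrow> lex_pos us v \<Longrightarrow> \<not> lex_pos us (- v)"
  using lex_pos_add[of us v "- v"] not_lex_pos_0 by auto

lemma lex_pos_sum:
  assumes "finite B" "\<And>b. b \<in> B \<Longrightarrow> lex_pos us b" "\<And>b. b \<in> B \<Longrightarrow> c b \<ge> 0"
  shows "(\<Sum>b\<in>B. c b *\<^sub>R b) = 0 \<or> lex_pos us (\<Sum>b\<in>B. c b *\<^sub>R b)"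
  using assms
proof (induction B rule: finite_induct)
  case (insert b B)
  have IH: "(\<Sum>b\<in>B. c b *\<^sub>R b) = 0 \<or> lex_pos us (\<Sum>b\<in>B. c b *\<^sub>R b)"
    using insert by blast
  show ?case
  proof (cases "c b = 0")
    case False
    then have "lex_pos us (c b *\<^sub>R b)" 
      using insert.prems(1)[of b] insert.prems(2)[of b] by (intro lex_pos_scaleR) auto
    then show ?thesis using IH insert.hyps by (auto intro: lex_pos_add)
  qed (use IH insert.hyps in auto)
qed simp

text \<open>A nonzero coefficient would make the remaining sum the negative of a positive vector,
  although that sum is zero or positive. This stands in for linear independence until the latter is
  proved.\<close>

lemma nonneg_sum_eq_0:
  assumes us: "ordered_basis us" and B: "finite B" "\<And>b. b \<in> B \<Longrightarrow> lex_pos us b" "\<And>b. b \<in> B \<Longrightarrow> c b \<ge> 0"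
    and 0: "(\<Sum>b\<in>B. c b *\<^sub>R b) = 0" and b: "b \<in> B"
  shows "c b = 0"
proof (rule ccontr)
  assume "c b \<noteq> 0"
  then have "lex_pos us (c b *\<^sub>R b)" using B(2,3)[OF b] by (intro lex_pos_scaleR) auto
  moreover have "(\<Sum>b\<in>B - {b}. c b *\<^sub>R b) = - (c b *\<^sub>R b)"
    using 0 b B(1) by (simp add: sum.remove[of B b] eq_neg_iff_add_eq_0 add.commute)
  moreover have "(\<Sum>b\<in>B - {b}. c b *\<^sub>R b) = 0 \<or> lex_pos us (\<Sum>b\<in>B - {b}. c b *\<^sub>R b)"
    using B by (intro lex_pos_sum) auto
  ultimately show False using lex_pos_uminus[OF us] not_lex_pos_0[OF us] by force
qed


section \<open>Roots and the simple system\<close>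

lemma refl_mat_uminus [simp]: "refl_mat (- a) = refl_mat a"
  by (simp add: refl_mat_def)

lemma refl_mat_scaleR: "c \<noteq> 0 \<Longrightarrow> refl_mat (c *\<^sub>R a) = refl_mat a"
  by (simp add: matrix_eq refl_mat_mult)

lemma roots_eq: "roots R = {a. norm a = 1 \<and> refl_mat a \<in> R}"
proof (intro equalityI subsetI)
  fix a assume "a \<in> roots R"
  then show "a \<in> {a. norm a = 1 \<and> refl_mat a \<in> R}"
    using refl_mat_root[of a R] by (auto simp: roots_def reflections_def)
next
  fix a assume a: "a \<in> {a. norm a = 1 \<and> refl_mat a \<in> R}"
  then have "a \<noteq> 0" by auto
  moreover have "orthogonal a x" if "refl_mat a *v x = x" for x
    using that \<open>a \<noteq> 0\<close> by (auto simp: refl_mat_mult orthogonal_def inner_commute)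
  ultimately show "a \<in> roots R" using a by (auto simp: roots_def reflections_def)
qed

lemma positive_roots_eq: "positive_roots R us = {a \<in> roots R. lex_pos us a}"
  by (simp add: positive_roots_def lex_pos_def)

section \<open>The reflection group and its action on the roots\<close>

locale reflection_system =
  fixes R :: "(real^'n^'n) set" and us :: "(real^'n) list" and \<Delta> :: "(real^'n) set"
  assumes reflection_group: "finite_reflection_group R"
    and basis: "ordered_basis us"
    and simple: "simple_system R us \<Delta>"
begin

text \<open>Normalizing a vector does not change its reflection, so every generator is the
  reflection in a root. Orthogonality and closure under transposes can then be read off
  words.\<close>

lemma words_roots: "R = wprod ` lists (roots R)"
proof -
  obtain A where A: "A \<subseteq> reflections R" "R = generate GL A" and sub: "subgroup R GL"
    using reflection_group by (auto simp: finite_reflection_group_def)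
  have "A \<subseteq> refl_mat ` roots R"
  proof
    fix t assume "t \<in> A"
    then obtain a where a: "a \<noteq> 0" "t = refl_mat a" "t \<in> R" using A(1) by (auto simp: reflections_def)
    then show "t \<in> refl_mat ` roots R"
      by (intro image_eqI[of _ _ "(1 / norm a) *\<^sub>R a"]) (auto simp: roots_eq refl_mat_scaleR)
  qed
  then have "R \<subseteq> generate GL (refl_mat ` roots R)"
    using group.mono_generate[OF group_GL, of A "refl_mat ` roots R"] A(2) by simp
  moreover have "generate GL (refl_mat ` roots R) \<subseteq> R"
    by (rule group.generate_subgroup_incl[OF group_GL _ sub]) (auto simp: roots_eq)
  ultimately show ?thesis by (simp add: generate_refl_mat)
qed

lemma mult_closed: "A \<in> R \<Longrightarrow> B \<in> R \<Longrightarrow> A ** B \<in> R"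
  using reflection_group subgroup.m_closed[of R GL A B]
  by (simp add: finite_reflection_group_def GL_def)

lemma one_closed: "mat 1 \<in> R"
  using reflection_group subgroup.one_closed[of R GL]
  by (simp add: finite_reflection_group_def GL_def)

lemma orthogonal_closed: "A \<in> R \<Longrightarrow> orthogonal_matrix A"
  using words_roots orthogonal_matrix_wprod by (metis imageE)

text \<open>Transposing a word reverses it. From here on the transpose serves as the inverse in
  \<open>R\<close>.\<close>

lemma transpose_closed:
  assumes "A \<in> R"
  shows "transpose A \<in> R"
proof -
  obtain as where "as \<in> lists (roots R)" "A = wprod as" using assms words_roots by blast
  then show ?thesis by (subst words_roots) (auto simp: transpose_wprod)
qed

lemma transpose_mult: "A \<in> R \<Longrightarrow> transpose A ** A = mat 1"
  and mult_transpose: "A \<in> R \<Longrightarrow> A ** transpose A = mat 1"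
  using orthogonal_closed by (auto simp: orthogonal_matrix_def)

lemma transpose_mult_vector: "A \<in> R \<Longrightarrow> transpose A *v (A *v x) = x"
  unfolding matrix_vector_mul_assoc by (simp add: transpose_mult)

lemma root_norm: "a \<in> roots R \<Longrightarrow> a \<bullet> a = 1"
  by (simp add: roots_eq norm_eq_1)

lemma root_nonzero: "a \<in> roots R \<Longrightarrow> a \<noteq> 0"
  by (auto simp: roots_eq)

lemma root_refl: "a \<in> roots R \<Longrightarrow> refl_mat a *v x = x - (2 * (x \<bullet> a)) *\<^sub>R a"
  by (simp add: refl_mat_mult root_norm)

lemma refl_closed: "a \<in> roots R \<Longrightarrow> refl_mat a \<in> R"
  by (simp add: roots_eq)

lemma root_uminus: "a \<in> roots R \<Longrightarrow> - a \<in> roots R"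
  by (simp add: roots_eq)

text \<open>The reflection in \<open>r *v a\<close> is the conjugate of \<open>refl_mat a\<close> by
  \<open>r\<close>, hence again in \<open>R\<close>.\<close>

lemma root_image:
  assumes r: "r \<in> R" and a: "a \<in> roots R"
  shows "r *v a \<in> roots R"
proof -
  have "refl_mat (r *v a) ** r ** transpose r = r ** refl_mat a ** transpose r"
    using r by (simp add: refl_mat_conj orthogonal_closed)
  then have "refl_mat (r *v a) = r ** refl_mat a ** transpose r"
    by (simp add: mult_transpose r flip: matrix_mul_assoc)
  moreover have "norm (r *v a) = 1"
    using a r by (simp add: norm_eq_1 orthogonal_matrix_inner orthogonal_closed root_norm)
  ultimately show ?thesis
    using r a by (simp add: roots_eq mult_closed transpose_closed)
qed

section \<open>Positive roots and the geometry of the simple system\<close>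

abbreviation "\<Phi> \<equiv> positive_roots R us"

lemma pos_root: "a \<in> \<Phi> \<Longrightarrow> a \<in> roots R"
  by (simp add: positive_roots_eq)

lemma pos_lex: "a \<in> \<Phi> \<Longrightarrow> lex_pos us a"
  by (simp add: positive_roots_eq)

lemma root_cases:
  assumes "a \<in> roots R"
  obtains "a \<in> \<Phi>" | "- a \<in> \<Phi>"
  using assms lex_pos_cases[OF basis root_nonzero[OF assms]] root_uminus
  by (auto simp: positive_roots_eq)

lemma uminus_not_pos: "a \<in> \<Phi> \<Longrightarrow> - a \<notin> \<Phi>"
  using lex_pos_uminus[OF basis] by (auto simp: positive_roots_eq)

lemma simple_pos: "a \<in> \<Delta> \<Longrightarrow> a \<in> \<Phi>"
  using simple by (auto simp: simple_system_def)

lemmas simple_root = pos_root[OF simple_pos]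

lemma finite_simple: "finite \<Delta>"
proof -
  have "finite (roots R)"
    using reflection_group finite_roots by (auto simp: finite_reflection_group_def)
  then show ?thesis using simple_root by (meson finite_subset subsetI)
qed

lemma pos_comb:
  assumes "b \<in> \<Phi>"
  shows "\<exists>c. (\<forall>a\<in>\<Delta>. c a \<ge> 0) \<and> b = (\<Sum>a\<in>\<Delta>. c a *\<^sub>R a)"
  using assms simple by (simp add: simple_system_def nonneg_spanning_def)

text \<open>Otherwise substituting the combination for \<open>a\<close> would show that
  \<open>\<Delta> - {a}\<close> is still non-negatively spanning, against minimality of
  \<open>\<Delta>\<close>.\<close>

lemma simple_not_comb:
  assumes a: "a \<in> \<Delta>" and c: "\<And>b. b \<in> \<Delta> - {a} \<Longrightarrow> c b \<ge> 0"
  shows "a \<noteq> (\<Sum>b\<in>\<Delta> - {a}. c b *\<^sub>R b)"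
proof
  assume eq: "a = (\<Sum>b\<in>\<Delta> - {a}. c b *\<^sub>R b)"
  have "nonneg_spanning (\<Delta> - {a}) \<Phi>"
    unfolding nonneg_spanning_def
  proof
    fix b assume "b \<in> \<Phi>"
    then obtain d where d: "\<And>a. a \<in> \<Delta> \<Longrightarrow> d a \<ge> 0" "b = (\<Sum>a\<in>\<Delta>. d a *\<^sub>R a)"
      using pos_comb by blast
    have "b = d a *\<^sub>R a + (\<Sum>b\<in>\<Delta> - {a}. d b *\<^sub>R b)"
      using d(2) a finite_simple by (simp add: sum.remove)
    also have "d a *\<^sub>R a = (\<Sum>b\<in>\<Delta> - {a}. (d a * c b) *\<^sub>R b)"
      by (subst eq) (simp add: scaleR_sum_right)
    finally have "b = (\<Sum>b\<in>\<Delta> - {a}. (d a * c b + d b) *\<^sub>R b)"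
      by (simp add: scaleR_add_left sum.distrib)
    moreover have "\<forall>b\<in>\<Delta> - {a}. d a * c b + d b \<ge> 0" using c d(1) a by simp
    ultimately show "\<exists>c. (\<forall>b\<in>\<Delta> - {a}. 0 \<le> c b) \<and> b = (\<Sum>b\<in>\<Delta> - {a}. c b *\<^sub>R b)"
      by (intro exI[of _ "\<lambda>b. d a * c b + d b"]) simp
  qed
  then show False using simple a by (auto simp: simple_system_def)
qed

text \<open>For positive \<open>k\<close>, dividing by \<open>k\<close> contradicts
  \<open>simple_not_comb\<close>. Otherwise moving \<open>k *\<^sub>R a\<close> to the right gives a
  vanishing combination of positive roots whose coefficients, including \<open>- k\<close>, are
  non-negative.\<close>

lemma multiple_simple_comb_eq_0:
  assumes a: "a \<in> \<Delta>" and c: "\<And>b. b \<in> \<Delta> - {a} \<Longrightarrow> c b \<ge> 0"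
    and eq: "k *\<^sub>R a = (\<Sum>b\<in>\<Delta> - {a}. c b *\<^sub>R b)" and b: "b \<in> \<Delta> - {a}"
  shows "c b = 0"
proof (cases "k > 0")
  case True
  have "a = (1 / k) *\<^sub>R (k *\<^sub>R a)" using True by simp
  also have "\<dots> = (\<Sum>b\<in>\<Delta> - {a}. (c b / k) *\<^sub>R b)"
    unfolding eq by (simp add: scaleR_sum_right)
  finally show ?thesis using simple_not_comb[OF a, of "\<lambda>b. c b / k"] c True by simp
next
  case False
  let ?d = "c(a := - k)"
  have "(\<Sum>b\<in>\<Delta> - {a}. ?d b *\<^sub>R b) = (\<Sum>b\<in>\<Delta> - {a}. c b *\<^sub>R b)"
    by (rule sum.cong) auto
  then have "(\<Sum>b\<in>\<Delta>. ?d b *\<^sub>R b) = 0"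
    using a finite_simple by (simp add: sum.remove eq[symmetric])
  then have "?d b = 0"
    using b c False by (intro nonneg_sum_eq_0[OF basis finite_simple]) (auto simp: simple_pos pos_lex)
  then show ?thesis using b by simp
qed

text \<open>If the product were positive, the root \<open>b - k *\<^sub>R a\<close> with
  \<open>k > 0\<close> would mix signs. Expanding it, or its negative, over \<open>\<Delta>\<close>
  and isolating \<open>b\<close>, respectively \<open>a\<close>, gives a relation excluded by
  \<open>multiple_simple_comb_eq_0\<close>: the coefficient \<open>k + e a\<close>, respectively
  \<open>1 + e b\<close>, is positive.\<close>

lemma simple_obtuse:
  assumes a: "a \<in> \<Delta>" and b: "b \<in> \<Delta>" and ne: "a \<noteq> b"
  shows "a \<bullet> b \<le> 0"
proof (rule ccontr)
  assume "\<not> a \<bullet> b \<le> 0"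
  define k where "k = 2 * (b \<bullet> a)"
  have k: "k > 0" using \<open>\<not> a \<bullet> b \<le> 0\<close> by (simp add: k_def inner_commute)
  have refl: "refl_mat a *v b = b - k *\<^sub>R a"
    by (simp add: root_refl simple_root a k_def)
  have "refl_mat a *v b \<in> roots R"
    by (simp add: root_image refl_closed simple_root a b)
  then show False
  proof (cases rule: root_cases)
    case 1
    then obtain e where e: "\<And>a. a \<in> \<Delta> \<Longrightarrow> e a \<ge> 0" "b - k *\<^sub>R a = (\<Sum>a\<in>\<Delta>. e a *\<^sub>R a)"
      unfolding refl using pos_comb by meson
    have "(1 - e b) *\<^sub>R b = k *\<^sub>R a + (\<Sum>b\<in>\<Delta> - {b}. e b *\<^sub>R b)"
      using e(2) b finite_simple by (simp add: sum.remove[of _ b] algebra_simps)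
    also have "k *\<^sub>R a = (\<Sum>c\<in>\<Delta> - {b}. (if c = a then k else 0) *\<^sub>R c)"
      using a ne finite_simple by (simp add: if_distrib[of "\<lambda>c. c *\<^sub>R _"] cong: if_cong)
    finally have "(1 - e b) *\<^sub>R b = (\<Sum>c\<in>\<Delta> - {b}. ((if c = a then k else 0) + e c) *\<^sub>R c)"
      by (simp add: scaleR_add_left sum.distrib)
    from multiple_simple_comb_eq_0[OF b _ this, of a] have "k + e a = 0"
      using a ne e(1) k by auto
    then show False using k e(1)[OF a] by simp
  next
    case 2
    then obtain e where e: "\<And>a. a \<in> \<Delta> \<Longrightarrow> e a \<ge> 0" "- (b - k *\<^sub>R a) = (\<Sum>a\<in>\<Delta>. e a *\<^sub>R a)"
      unfolding refl using pos_comb by meson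
    have "(k - e a) *\<^sub>R a = b + (\<Sum>b\<in>\<Delta> - {a}. e b *\<^sub>R b)"
      using e(2) a finite_simple by (simp add: sum.remove[of _ a] algebra_simps)
    also have "b = (\<Sum>c\<in>\<Delta> - {a}. (if c = b then 1 else 0) *\<^sub>R c)"
      using b ne finite_simple by (simp add: if_distrib[of "\<lambda>c. c *\<^sub>R _"] cong: if_cong)
    finally have "(k - e a) *\<^sub>R a = (\<Sum>c\<in>\<Delta> - {a}. ((if c = b then 1 else 0) + e c) *\<^sub>R c)"
      by (simp add: scaleR_add_left sum.distrib)
    from multiple_simple_comb_eq_0[OF a _ this, of b] have "1 + e b = 0"
      using b ne e(1) by auto
    then show False using e(1)[OF b] by simp
  qed
qed

text \<open>Moving the negative coefficients of a relation to the other side equates two non-negative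
  combinations with disjoint supports; since the simple roots are pairwise obtuse, their common
  value has non-positive norm.\<close>

lemma simple_independent: "independent \<Delta>"
proof (rule independent_if_scalars_zero[OF finite_simple])
  fix f x assume 0: "(\<Sum>x\<in>\<Delta>. f x *\<^sub>R x) = 0" and x: "x \<in> \<Delta>"
  define v where "v = (\<Sum>a\<in>\<Delta>. max (f a) 0 *\<^sub>R a)"
  have "v - (\<Sum>a\<in>\<Delta>. max (- f a) 0 *\<^sub>R a) = (\<Sum>a\<in>\<Delta>. f a *\<^sub>R a)"
    unfolding v_def sum_subtractf[symmetric]
    by (rule sum.cong) (auto simp: max_def simp flip: scaleR_diff_left)
  then have v': "v = (\<Sum>a\<in>\<Delta>. max (- f a) 0 *\<^sub>R a)" using 0 by simp
  have "v \<bullet> v = (\<Sum>a\<in>\<Delta>. \<Sum>b\<in>\<Delta>. (max (- f a) 0 * max (f b) 0) * (b \<bullet> a))"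
    by (subst (2) v') (simp add: v_def inner_sum_left inner_sum_right sum_distrib_left mult.assoc)
  also have "\<dots> \<le> 0"
  proof (intro sum_nonpos)
    fix a b assume "a \<in> \<Delta>" "b \<in> \<Delta>"
    then show "(max (- f a) 0 * max (f b) 0) * (b \<bullet> a) \<le> 0"
      using simple_obtuse[of b a]
      by (cases "a = b") (simp add: max_def, intro mult_nonneg_nonpos mult_nonneg_nonneg, auto)
  qed
  finally have "v = 0" by (metis inner_gt_zero_iff not_less)
  have "max (f x) 0 = 0"
    using x \<open>v = 0\<close> unfolding v_def
    by (intro nonneg_sum_eq_0[OF basis finite_simple _ _ _ x]) (auto simp: simple_pos pos_lex)
  moreover have "max (- f x) 0 = 0"
    using x \<open>v = 0\<close> unfolding v'
    by (intro nonneg_sum_eq_0[OF basis finite_simple _ _ _ x]) (auto simp: simple_pos pos_lex)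
  ultimately show "f x = 0" by simp
qed

text \<open>By independence a linear functional takes the prescribed values on
  \<open>\<Delta>\<close>; \<open>adjoint g 1\<close> is the vector representing the functional
  \<open>g\<close>.\<close>

lemma ex_inner_simple: "\<exists>x. \<forall>a\<in>\<Delta>. x \<bullet> a = f a"
proof -
  obtain g where g: "linear g" "\<forall>a\<in>\<Delta>. g a = f a"
    using linear_independent_extend[OF simple_independent, of f] by blast
  have "adjoint g 1 \<bullet> a = g a" for a
    using adjoint_works[OF g(1), of a 1] by (simp add: inner_commute)
  then show ?thesis using g(2) by (intro exI[of _ "adjoint g 1"]) simp
qed

text \<open>Pairing with this vector gives the height of a root, the sum of its coefficients over
  \<open>\<Delta>\<close>. Any choice works, since only the values on \<open>\<Delta>\<close>
  matter.\<close>

definition "\<rho> = (SOME x. \<forall>a\<in>\<Delta>. x \<bullet> a = 1)"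

lemma rho_simple: "a \<in> \<Delta> \<Longrightarrow> \<rho> \<bullet> a = 1"
  using someI_ex[OF ex_inner_simple[of "\<lambda>_. 1"]] unfolding \<rho>_def by blast

lemma rho_pos:
  assumes "b \<in> \<Phi>"
  shows "\<rho> \<bullet> b > 0"
proof -
  obtain c where c: "\<And>a. a \<in> \<Delta> \<Longrightarrow> c a \<ge> 0" "b = (\<Sum>a\<in>\<Delta>. c a *\<^sub>R a)"
    using pos_comb[OF assms] by blast
  have eq: "\<rho> \<bullet> b = (\<Sum>a\<in>\<Delta>. c a)" using c(2) by (simp add: inner_sum_right rho_simple)
  have "\<rho> \<bullet> b \<noteq> 0"
  proof
    assume "\<rho> \<bullet> b = 0"
    then have "\<forall>a\<in>\<Delta>. c a = 0" using eq c(1) finite_simple by (simp add: sum_nonneg_eq_0_iff)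
    then have "b = 0" using c(2) by simp
    then show False using root_nonzero pos_root assms by blast
  qed
  moreover have "\<rho> \<bullet> b \<ge> 0" using eq c(1) by (simp add: sum_nonneg)
  ultimately show ?thesis by simp
qed

text \<open>Reflecting in \<open>a\<close> changes only the coefficient of \<open>a\<close>. If the
  image were negative, all other coefficients of \<open>b\<close> would vanish, and unit length
  would force \<open>b = a\<close>.\<close>

lemma simple_refl_pos:
  assumes a: "a \<in> \<Delta>" and b: "b \<in> \<Phi>" and ne: "b \<noteq> a"
  shows "refl_mat a *v b \<in> \<Phi>"
proof (rule ccontr)
  define k where "k = 2 * (b \<bullet> a)"
  have refl: "refl_mat a *v b = b - k *\<^sub>R a"
    by (simp add: root_refl simple_root a k_def)
  assume "refl_mat a *v b \<notin> \<Phi>"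
  moreover have "refl_mat a *v b \<in> roots R"
    by (simp add: root_image refl_closed simple_root a pos_root b)
  ultimately have "- (refl_mat a *v b) \<in> \<Phi>" using root_cases by blast
  then obtain d where d: "\<And>a. a \<in> \<Delta> \<Longrightarrow> d a \<ge> 0" "- (b - k *\<^sub>R a) = (\<Sum>a\<in>\<Delta>. d a *\<^sub>R a)"
    unfolding refl using pos_comb by meson
  obtain c where c: "\<And>a. a \<in> \<Delta> \<Longrightarrow> c a \<ge> 0" "b = (\<Sum>a\<in>\<Delta>. c a *\<^sub>R a)"
    using pos_comb[OF b] by blast
  have "k *\<^sub>R a = (\<Sum>b\<in>\<Delta>. (c b + d b) *\<^sub>R b)"
    using c(2) d(2) by (simp add: scaleR_add_left sum.distrib algebra_simps)
  then have "(k - c a - d a) *\<^sub>R a = (\<Sum>b\<in>\<Delta> - {a}. (c b + d b) *\<^sub>R b)"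
    using a finite_simple by (simp add: sum.remove algebra_simps)
  from multiple_simple_comb_eq_0[OF a _ this] have 0: "c e + d e = 0" if "e \<in> \<Delta> - {a}" for e
    using c(1) d(1) that by auto
  have "c e = 0" if "e \<in> \<Delta> - {a}" for e
    using 0[OF that] c(1)[of e] d(1)[of e] that by simp
  then have "b = c a *\<^sub>R a"
    using c(2) a finite_simple by (simp add: sum.remove)
  moreover from this have "c a = 1"
    using root_norm[OF pos_root[OF b]] root_norm[OF simple_root[OF a]] c(1)[OF a]
    by (simp add: abs_square_eq_1 flip: power2_eq_square)
  ultimately show False using ne by simp
qed

text \<open>A root of least height in the orbit of a positive root is simple.\<close>

lemma words_simple: "R = wprod ` lists \<Delta>"
proof -
  let ?W = "generate GL (refl_mat ` \<Delta>)"
  have sub: "subgroup ?W GL"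
    by (rule group.generate_is_subgroup[OF group_GL]) (auto simp: GL_def invertible_refl_mat)
  have W: "?W = wprod ` lists \<Delta>" by (rule generate_refl_mat)
  have WR: "?W \<subseteq> R"
    using words_roots simple_root unfolding W by (auto simp: lists_eq_set)
  have fin: "finite (roots R)"
    using reflection_group finite_roots by (auto simp: finite_reflection_group_def)
  have "refl_mat b \<in> ?W" if b: "b \<in> \<Phi>" for b
  proof -
    define Q where "Q = {c \<in> \<Phi>. \<exists>w\<in>?W. c = w *v b}"
    have "finite Q" using fin by (rule finite_subset[rotated]) (auto simp: Q_def pos_root)
    moreover have "b \<in> Q" using b subgroup.one_closed[OF sub]
      by (auto simp: Q_def GL_def intro!: bexI[of _ "mat 1"])
    ultimately obtain c where c: "c \<in> Q" "\<And>d. d \<in> Q \<Longrightarrow> \<rho> \<bullet> c \<le> \<rho> \<bullet> d"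
      using ex_min_if_finite[of "(\<lambda>c. \<rho> \<bullet> c) ` Q"] by (fastforce simp: not_less)
    then obtain w where w: "w \<in> ?W" "c = w *v b" "c \<in> \<Phi>" by (auto simp: Q_def)
    obtain k where k: "\<And>a. a \<in> \<Delta> \<Longrightarrow> k a \<ge> 0" "c = (\<Sum>a\<in>\<Delta>. k a *\<^sub>R a)"
      using pos_comb[OF w(3)] by blast
    have "c \<bullet> c > 0" using root_norm[OF pos_root[OF w(3)]] by simp
    \<comment> \<open>Otherwise expanding one factor of \<open>c \<bullet> c\<close> over
      \<open>\<Delta>\<close> would make it non-positive.\<close>
    have "\<exists>a\<in>\<Delta>. c \<bullet> a > 0"
    proof (rule ccontr)
      assume *: "\<not> (\<exists>a\<in>\<Delta>. c \<bullet> a > 0)"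
      have "c \<bullet> c = (\<Sum>a\<in>\<Delta>. k a * (c \<bullet> a))"
        by (subst (2) k(2)) (simp add: inner_sum_right)
      also have "\<dots> \<le> 0" using * k(1) by (intro sum_nonpos mult_nonneg_nonpos) (auto simp: not_less)
      finally show False using \<open>c \<bullet> c > 0\<close> by simp
    qed
    then obtain a where a: "a \<in> \<Delta>" "c \<bullet> a > 0" by blast
    \<comment> \<open>If not, reflecting \<open>c\<close> in \<open>a\<close> stays in
      \<open>Q\<close> and lowers the height by \<open>2 * (c \<bullet> a)\<close>.\<close>
    have "c = a"
    proof (rule ccontr)
      assume "c \<noteq> a"
      then have "refl_mat a *v c \<in> \<Phi>" using simple_refl_pos[OF a(1) w(3)] by simp
      moreover have "refl_mat a ** w \<in> ?W"
        using subgroup.m_closed[OF sub generate.incl w(1), of "refl_mat a"] a(1) by (simp add: GL_def)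
      ultimately have "refl_mat a *v c \<in> Q"
        by (auto simp: Q_def w(2) matrix_vector_mul_assoc)
      then have "\<rho> \<bullet> c \<le> \<rho> \<bullet> (refl_mat a *v c)" by (rule c(2))
      then show False using a by (simp add: root_refl simple_root inner_diff_right rho_simple)
    qed
    have wR: "w \<in> R" using w(1) WR by blast
    obtain as where as: "as \<in> lists \<Delta>" "w = wprod as" using w(1) W by blast
    \<comment> \<open>Since \<open>w\<close> carries \<open>b\<close> to \<open>a\<close>, the
      reflection in \<open>b\<close> is the conjugate of that in \<open>a\<close>, which is this
      word in simple roots.\<close>
    have tr: "transpose w ** refl_mat a ** w = wprod (rev as @ a # as)"
      by (simp add: as(2) transpose_wprod matrix_mul_assoc)
    have "refl_mat a ** w = w ** refl_mat b"
      using refl_mat_conj[of w b] orthogonal_closed[OF wR] w(2) \<open>c = a\<close> by simp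
    then have "refl_mat b = transpose w ** refl_mat a ** w"
      by (metis matrix_mul_assoc matrix_mul_lid transpose_mult wR)
    then show ?thesis using as(1) a(1) unfolding tr W
      by (intro image_eqI[of _ _ "rev as @ a # as"]) auto
  qed
  then have "refl_mat b \<in> ?W" if "b \<in> roots R" for b
    using that by (metis refl_mat_uminus root_cases)
  then have "generate GL (refl_mat ` roots R) \<subseteq> ?W"
    by (intro group.generate_subgroup_incl[OF group_GL _ sub]) auto
  then show ?thesis using WR words_roots by (simp add: generate_refl_mat)
qed

section \<open>Exchange property and the closed fundamental chamber\<close>

lemma wprod_closed: "as \<in> lists \<Delta> \<Longrightarrow> wprod as \<in> R"
  by (metis imageI words_simple)

text \<open>Apply the letters to \<open>b\<close> from the right. At the first letter
  \<open>a\<close> that turns the root negative, the root must equal \<open>a\<close> by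
  \<open>simple_refl_pos\<close>; conjugation then shows that multiplying by
  \<open>refl_mat b\<close> deletes this letter. The word need not be reduced.\<close>

lemma exchange:
  assumes "as \<in> lists \<Delta>" "b \<in> \<Delta>" "wprod as *v b \<notin> \<Phi>"
  shows "\<exists>bs\<in>lists \<Delta>. length bs < length as \<and> wprod bs = wprod as ** refl_mat b"
  using assms
proof (induction as rule: list.induct)
  case Nil
  then show ?case by (simp add: simple_pos)
next
  case (Cons a as)
  have asR: "wprod as \<in> R" using Cons.prems wprod_closed by simp
  show ?case
  proof (cases "wprod as *v b \<in> \<Phi>")
    case True
    have "wprod as *v b = a"
      using simple_refl_pos[of a "wprod as *v b"] True Cons.prems by (auto simp: matrix_vector_mul_assoc)
    then have "refl_mat a ** wprod as = wprod as ** refl_mat b"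
      using refl_mat_conj[OF orthogonal_closed[OF asR], of b] by simp
    then have "wprod (a # as) ** refl_mat b = wprod as"
      by (simp flip: matrix_mul_assoc)
    then show ?thesis using Cons.prems by (intro bexI[of _ as]) auto
  next
    case False
    then obtain bs where "bs \<in> lists \<Delta>" "length bs < length as" "wprod bs = wprod as ** refl_mat b"
      using Cons by auto
    then show ?thesis using Cons.prems
      by (intro bexI[of _ "a # bs"]) (auto simp: matrix_mul_assoc)
  qed
qed

text \<open>Membership in the closed fundamental chamber.\<close>

definition "dominant x \<longleftrightarrow> (\<forall>a\<in>\<Delta>. x \<bullet> a \<ge> 0)"

lemma dominant_pos:
  assumes "dominant x" "b \<in> \<Phi>"
  shows "x \<bullet> b \<ge> 0"
proof -
  obtain c where c: "\<And>a. a \<in> \<Delta> \<Longrightarrow> c a \<ge> 0" "b = (\<Sum>a\<in>\<Delta>. c a *\<^sub>R a)"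
    using pos_comb[OF assms(2)] by blast
  then show ?thesis using assms(1) by (auto simp: inner_sum_right dominant_def intro!: sum_nonneg)
qed

text \<open>Induction on the word length: a shorter word comes from the exchange property
  when the last letter can be cancelled, and otherwise that letter fixes \<open>x\<close>.\<close>

lemma dominant_unique_word:
  assumes "as \<in> lists \<Delta>" "dominant x" "dominant (wprod as *v x)"
  shows "wprod as \<in> wprod ` lists {a \<in> \<Delta>. x \<bullet> a = 0}"
  using assms
proof (induction "length as" arbitrary: as rule: less_induct)
  case less
  show ?case
  proof (cases as rule: rev_cases)
    case Nil
    then show ?thesis by (intro image_eqI[of _ _ "[]"]) auto
  next
    case (snoc bs b)
    have b: "b \<in> \<Delta>" and bs: "bs \<in> lists \<Delta>" using less.prems snoc by auto
    have asR: "wprod as \<in> R" using less.prems wprod_closed by simp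
    have root: "wprod as *v b \<in> roots R" using root_image[OF asR simple_root[OF b]] .
    have eq: "wprod as *v b = - (wprod bs *v b)"
      by (simp add: snoc flip: matrix_vector_mul_assoc) 
        (metis matrix_vector_mult_0_right matrix_vector_mult_diff_distrib diff_0)
    from root show ?thesis
    proof (cases rule: root_cases)
      case 1
      then have "wprod bs *v b \<notin> \<Phi>" using uminus_not_pos[of "wprod bs *v b"] eq by auto
      \<comment> \<open>Here \<open>wprod cs = wprod as\<close> with a shorter word, so the
        induction hypothesis applies directly.\<close>
      then obtain cs where "cs \<in> lists \<Delta>" "length cs < length bs" "wprod cs = wprod bs ** refl_mat b"
        using exchange[OF bs b] by blast
      then show ?thesis using less.hyps[of cs] less.prems by (simp add: snoc)
    next
      case 2
      \<comment> \<open>Dominance of \<open>x\<close> makes this product non-negative, while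
        dominance of its image makes it non-positive.\<close>
      have "x \<bullet> b = (wprod as *v x) \<bullet> (wprod as *v b)"
        by (simp add: orthogonal_matrix_inner orthogonal_closed asR)
      also have "\<dots> \<le> 0" using dominant_pos[OF less.prems(3) 2] by simp
      finally have xb: "x \<bullet> b = 0" using less.prems(2) b by (force simp: dominant_def)
      then have "wprod as *v x = wprod bs *v x"
        by (simp add: snoc root_refl simple_root b flip: matrix_vector_mul_assoc)
      then obtain cs where "cs \<in> lists {a \<in> \<Delta>. x \<bullet> a = 0}" "wprod bs = wprod cs"
        using less.hyps[of bs] less.prems bs snoc by auto
      then show ?thesis using xb b by (intro image_eqI[of _ _ "cs @ [b]"]) (auto simp: snoc)
    qed
  qed
qed

text \<open>The generators named here fix \<open>x\<close>. Hence an orbit meets the closed chamber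
  only once, and the stabilizer of a dominant point is generated by the simple reflections fixing
  it.\<close>

lemma dominant_unique:
  assumes "w \<in> R" "dominant x" "dominant (w *v x)"
  shows "w \<in> generate GL (refl_mat ` {a \<in> \<Delta>. x \<bullet> a = 0})"
  using assms dominant_unique_word words_simple unfolding generate_refl_mat by blast

end


section \<open>Folds and percolation of bigraphs\<close>

text \<open>The function \<open>sg\<close> is odd under \<open>\<phi>\<close>, vanishes only at
  fixed vertices and never has opposite signs along an edge. Once the fixed vertices are deleted,
  its sign is therefore constant on components, and the positive ones form the left side.\<close>

lemma foldI:
  fixes sg :: "'v \<Rightarrow> real"
  assumes wf: "edges G \<subseteq> V1 G \<times> V2 G"
    and V1: "\<And>v. v \<in> V1 G \<Longrightarrow> \<phi> v \<in> V1 G" and V2: "\<And>v. v \<in> V2 G \<Longrightarrow> \<phi> v \<in> V2 G"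
    and inv: "\<And>v. v \<in> verts G \<Longrightarrow> \<phi> (\<phi> v) = v"
    and edge: "\<And>u v. (u, v) \<in> edges G \<Longrightarrow> (\<phi> u, \<phi> v) \<in> edges G"
    and sg_uminus: "\<And>v. v \<in> verts G \<Longrightarrow> sg (\<phi> v) = - sg v"
    and sg_0: "\<And>v. v \<in> verts G \<Longrightarrow> sg v = 0 \<Longrightarrow> \<phi> v = v"
    and sg_edge: "\<And>u v. (u, v) \<in> edges G \<Longrightarrow> sg u * sg v \<ge> 0"
    and w: "w \<in> verts G" "sg w \<noteq> 0"
  shows "(\<phi>, {v \<in> verts G. sg v > 0}) \<in> folds G"
proof -
  define L where "L = {v \<in> verts G. sg v > 0}"
  define D where "D = delete G (Fix G \<phi>)"
  have VG: "\<phi> v \<in> verts G" if "v \<in> verts G" for v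
    using that V1 V2 by (auto simp: verts_def)
  have Fix: "Fix G \<phi> = {v \<in> verts G. sg v = 0}"
    using sg_0 sg_uminus by (force simp: Fix_def)
  have vD: "verts D = {v \<in> verts G. sg v \<noteq> 0}"
    by (auto simp: D_def delete_def induced_def Fix verts_def)
  have eD: "edges D \<subseteq> edges G \<inter> verts D \<times> verts D"
    unfolding vD by (auto simp: D_def delete_def induced_def Fix)
  have linked: "sg u * sg v > 0" if "(u, v) \<in> linked D" for u v
  proof -
    have "(u, v) \<in> (edges D \<union> (edges D)\<inverse>)\<^sup>*" "u \<in> verts D" using that by (auto simp: linked_def)
    then show ?thesis
    proof (induction rule: rtrancl_induct)
      case base
      then show ?case by (auto simp: vD zero_less_mult_iff)
    next
      case (step x y)
      have "sg x * sg y \<ge> 0"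
        using step.hyps(2) sg_edge[of x y] sg_edge[of y x] eD by (auto simp: mult.commute)
      moreover have "sg x \<noteq> 0" "sg y \<noteq> 0" using step.hyps(2) eD vD by auto
      ultimately show ?case using step by (auto simp: zero_less_mult_iff zero_le_mult_iff)
    qed
  qed
  have linked_refl: "(u, u) \<in> linked D" if "u \<in> verts D" for u using that by (simp add: linked_def)
  have comp: "linked D `` {u} \<in> conn_components D" if "u \<in> verts D" for u
    using that by (auto simp: conn_components_def quotient_def)
  have wD: "w \<in> verts D" "\<phi> w \<in> verts D" using w VG sg_uminus by (auto simp: vD)
  \<comment> \<open>The values at \<open>w\<close> and \<open>\<phi> w\<close> have opposite signs,
    so these vertices witness disconnectedness.\<close>
  have "w \<notin> linked D `` {\<phi> w}"
    using linked[of "\<phi> w" w] sg_uminus[OF w(1)] by (auto simp: mult_less_0_iff zero_less_mult_iff)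
  then have "linked D `` {w} \<noteq> linked D `` {\<phi> w}" using linked_refl[OF wD(1)] by blast
  then have disc: "disconnected D" using comp[OF wD(1)] comp[OF wD(2)] unfolding disconnected_def by meson
  have surj: "\<phi> ` A = A" if A: "A \<subseteq> verts G" "\<And>v. v \<in> A \<Longrightarrow> \<phi> v \<in> A" for A
  proof (intro equalityI subsetI)
    fix v assume "v \<in> A"
    then show "v \<in> \<phi> ` A" using A inv by (intro image_eqI[of _ _ "\<phi> v"]) auto
  qed (use A in auto)
  have "inj_on \<phi> (verts G)" using inv by (metis inj_onI)
  moreover have "\<phi> ` verts G = verts G" using VG by (intro surj) auto
  moreover have "\<phi> ` V1 G = V1 G" "\<phi> ` V2 G = V2 G"
    using V1 V2 by (auto intro!: surj simp: verts_def)
  moreover have "(\<phi> u, \<phi> v) \<in> edges G \<longleftrightarrow> (u, v) \<in> edges G" if "u \<in> V1 G" "v \<in> V2 G" for u v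
    using that edge[of u v] edge[of "\<phi> u" "\<phi> v"] inv by (auto simp: verts_def)
  ultimately have "automorphism G \<phi>" by (auto simp: automorphism_def bij_betw_def)
  then have cut: "cut_involution G \<phi>" using inv disc by (simp add: cut_involution_def D_def)
  have comps: "\<exists>\<C> \<subseteq> conn_components D. L = \<Union>\<C>"
  proof (intro exI conjI)
    show "(\<lambda>v. linked D `` {v}) ` L \<subseteq> conn_components D"
      using comp by (auto simp: L_def vD)
    have closed: "v \<in> L" if "u \<in> L" "(u, v) \<in> linked D" for u v
      using that linked[OF that(2)] by (auto simp: L_def zero_less_mult_iff linked_def vD)
    have "(v, v) \<in> linked D" if "v \<in> L" for v
      using that by (intro linked_refl) (simp add: L_def vD)
    then show "L = \<Union> ((\<lambda>v. linked D `` {v}) ` L)"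
      using closed by blast
  qed
  have img: "\<phi> ` L = {v \<in> verts G. sg v < 0}"
  proof (intro equalityI subsetI)
    fix v assume v: "v \<in> {v \<in> verts G. sg v < 0}"
    then show "v \<in> \<phi> ` L" using inv VG sg_uminus by (intro image_eqI[of _ _ "\<phi> v"]) (auto simp: L_def)
  qed (use VG sg_uminus in \<open>auto simp: L_def\<close>)
  have "L \<union> Fix G \<phi> \<union> \<phi> ` L = verts G" "L \<inter> Fix G \<phi> = {}" "L \<inter> \<phi> ` L = {}"
    "Fix G \<phi> \<inter> \<phi> ` L = {}" "L \<subseteq> verts G"
    unfolding img Fix unfolding L_def by auto
  then have "(\<phi>, L) \<in> folds G" using cut comps by (simp add: folds_def D_def)
  then show ?thesis by (simp only: L_def)
qed

text \<open>Percolation pulls back \<open>{v\<^sub>0}\<close> along a composite of left-folding maps, so it suffices that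
  some composite is constant on \<open>V1 G\<close>. A composite maximizing the total potential is.\<close>

lemma left_cut_percolatingI:
  fixes h :: "'v \<Rightarrow> real"
  assumes wf: "wf_bigraph G" and S: "S \<subseteq> folds G" and v0: "v0 \<in> V1 G"
    and mono: "\<And>\<phi> L v. (\<phi>, L) \<in> S \<Longrightarrow> v \<in> V1 G \<Longrightarrow>
      left_folding \<phi> L v = v \<or> h v < h (left_folding \<phi> L v)"
    and prog: "\<And>v. v \<in> V1 G \<Longrightarrow> v \<noteq> v0 \<Longrightarrow> \<exists>(\<phi>, L)\<in>S. left_folding \<phi> L v \<noteq> v"
  shows "left_cut_percolating G S"
proof -
  define F where "F = (\<lambda>(\<phi>, L). left_folding \<phi> L) ` S"
  define W where "W = (\<lambda>fs. foldr (\<circ>) fs id) ` lists F"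
  have fin: "finite (V1 G)" and disj: "V1 G \<inter> V2 G = {}" using wf by (auto simp: wf_bigraph_def)
  have S': "\<phi> ` V1 G = V1 G" "\<phi> ` V2 G = V2 G" if "(\<phi>, L) \<in> S" for \<phi> L
  proof -
    have "(\<phi>, L) \<in> folds G" using that S by blast
    then show "\<phi> ` V1 G = V1 G" "\<phi> ` V2 G = V2 G"
      by (simp_all add: folds_def cut_involution_def automorphism_def)
  qed
  have F1: "f v \<in> V1 G" if "f \<in> F" "v \<in> V1 G" for f v
    using that S'(1) by (force simp: F_def left_folding_def)
  have F2: "f v \<in> V2 G" if "f \<in> F" "v \<in> V2 G" for f v
    using that S'(2) by (force simp: F_def left_folding_def)
  have fs: "(v \<in> V1 G \<longrightarrow> foldr (\<circ>) fs id v \<in> V1 G) \<and> (v \<in> V2 G \<longrightarrow> foldr (\<circ>) fs id v \<in> V2 G)"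
    if "fs \<in> lists F" for fs v
    using that by (induction fs) (auto simp: F1 F2)
  define H where "H g = (\<Sum>v\<in>V1 G. h (g v))" for g :: "'v \<Rightarrow> 'v"
  \<comment> \<open>There may be infinitely many words, but \<open>H\<close> sees only the
    restriction to \<open>V1 G\<close>, one of finitely many self-maps; so a maximum exists.\<close>
  have "H ` W \<subseteq> H ` (V1 G \<rightarrow>\<^sub>E V1 G)"
  proof
    fix x assume "x \<in> H ` W"
    then obtain gs where "gs \<in> lists F" "x = H (foldr (\<circ>) gs id)" by (auto simp: W_def)
    then show "x \<in> H ` (V1 G \<rightarrow>\<^sub>E V1 G)"
      using fs by (intro image_eqI[of _ _ "restrict (foldr (\<circ>) gs id) (V1 G)"]) (auto simp: H_def)
  qed
  then have finH: "finite (H ` W)"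
    by (rule finite_subset) (intro finite_imageI finite_PiE fin)
  have "H (foldr (\<circ>) [] id) \<in> H ` W" unfolding W_def by (intro imageI) auto
  then obtain g where g: "g \<in> W" "\<And>g'. g' \<in> W \<Longrightarrow> H g' \<le> H g"
    using Max_in[OF finH] Max_ge[OF finH] by (metis (no_types, lifting) empty_iff imageE imageI)
  then obtain gs where gs: "gs \<in> lists F" "g = foldr (\<circ>) gs id" by (auto simp: W_def)
  have const: "g v = v0" if v: "v \<in> V1 G" for v
  proof (rule ccontr)
    assume ne: "g v \<noteq> v0"
    have gv: "g u \<in> V1 G" if "u \<in> V1 G" for u using fs[OF gs(1)] gs(2) that by auto
    obtain \<phi> L where p: "(\<phi>, L) \<in> S" "left_folding \<phi> L (g v) \<noteq> g v"
      using prog[OF gv[OF v] ne] by auto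
    \<comment> \<open>One further left-folding moves the value at \<open>v\<close> strictly up and
      lowers no other term, contradicting maximality.\<close>
    have "H g < H (left_folding \<phi> L \<circ> g)"
      unfolding H_def
    proof (rule sum_strict_mono_ex1[OF fin])
      show "\<forall>u\<in>V1 G. h (g u) \<le> h ((left_folding \<phi> L \<circ> g) u)"
        using mono[OF p(1) gv] by force
      show "\<exists>u\<in>V1 G. h (g u) < h ((left_folding \<phi> L \<circ> g) u)"
        using mono[OF p(1) gv[OF v]] p(2) v by force
    qed
    moreover have "left_folding \<phi> L \<circ> g \<in> W"
      unfolding W_def using p(1) gs by (intro image_eqI[of _ _ "left_folding \<phi> L # gs"]) (auto simp: F_def)
    ultimately show False using g(2) by force
  qed
  define st where "st U U' \<longleftrightarrow> (\<exists>(\<phi>, L)\<in>S. U' = {v \<in> verts G. left_folding \<phi> L v \<in> U})" for U U'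
  \<comment> \<open>Left-folding maps send \<open>V2 G\<close> to itself, so pulling back a subset
    of \<open>V1 G\<close> adds no vertex of \<open>V2 G\<close>.\<close>
  have stV: "U' \<subseteq> V1 G" if U: "st U U'" "U \<subseteq> V1 G" for U U'
  proof
    fix v assume "v \<in> U'"
    obtain \<phi> L where p: "(\<phi>, L) \<in> S" "U' = {v \<in> verts G. left_folding \<phi> L v \<in> U}"
      using U(1) unfolding st_def by blast
    have "left_folding \<phi> L v \<in> V1 G" "v \<in> verts G" using \<open>v \<in> U'\<close> p(2) U(2) by auto
    moreover have "left_folding \<phi> L \<in> F" using p(1) by (force simp: F_def)
    ultimately show "v \<in> V1 G" using F2[of "left_folding \<phi> L" v] disj by (auto simp: verts_def)
  qed
  have reach: "st\<^sup>*\<^sup>* U {v \<in> verts G. foldr (\<circ>) fs id v \<in> U}" if "fs \<in> lists F" "U \<subseteq> V1 G" for fs U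
    using that
  proof (induction fs arbitrary: U rule: list.induct)
    case Nil
    then have "{v \<in> verts G. v \<in> U} = U" by (auto simp: verts_def)
    then show ?case by simp
  next
    case (Cons f gs)
    \<comment> \<open>The head of the list is the outermost map of the composite, so its preimage is
      taken first.\<close>
    let ?U = "{v \<in> verts G. f v \<in> U}"
    have st: "st U ?U" using Cons.prems(1) by (auto simp: st_def F_def)
    have "st\<^sup>*\<^sup>* ?U {v \<in> verts G. foldr (\<circ>) gs id v \<in> ?U}"
      using Cons.prems by (intro Cons.IH stV[OF st]) auto
    moreover have "{v \<in> verts G. foldr (\<circ>) gs id v \<in> ?U} = {v \<in> verts G. foldr (\<circ>) (f # gs) id v \<in> U}"
      using fs[of gs] Cons.prems(1) by (auto simp: verts_def)
    ultimately show ?case using st by (metis (no_types, lifting) converse_rtranclp_into_rtranclp)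
  qed
  have "{v \<in> verts G. g v \<in> {v0}} = V1 G"
    using const fs[OF gs(1)] disj v0 by (auto simp: verts_def gs(2))
  then have "st\<^sup>*\<^sup>* {v0} (V1 G)" using reach[OF gs(1), of "{v0}"] v0 gs(2) by simp
  then obtain m U where U: "U 0 = {v0}" "U m = V1 G" "\<And>i. i < m \<Longrightarrow> st (U i) (U (Suc i))"
    by (metis rtranclp_imp_relpowp relpowp_fun_conv)
  have sub: "U i \<subseteq> V1 G" if "i \<le> m" for i
    using that
  proof (induction i)
    case (Suc i)
    then show ?case using stV[OF U(3)[of i]] by simp
  qed (use U(1) v0 in simp)
  have "\<exists>(\<phi>, L)\<in>S. U i = {v \<in> verts G. left_folding \<phi> L v \<in> U (i - 1)}" if "i \<in> {1..m}" for i
  proof -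
    have "i - 1 < m" "Suc (i - 1) = i" using that by auto
    then show ?thesis using U(3)[of "i - 1"] by (simp add: st_def)
  qed
  then show ?thesis unfolding left_cut_percolating_def
    using U sub by (intro exI[of _ m] exI[of _ U]) auto
qed


section \<open>Cosets as points\<close>

context reflection_system
begin

text \<open>Applying both reflections to \<open>a\<close> makes \<open>a\<close> a multiple of
  \<open>b\<close>; unit norms leave only the two signs, and positivity excludes the negative one.
  This makes \<open>root_of\<close> well defined.\<close>

lemma refl_mat_inj:
  assumes a: "a \<in> \<Phi>" and b: "b \<in> \<Phi>" and eq: "refl_mat b = refl_mat a"
  shows "b = a"
proof -
  define c where "c = a \<bullet> b"
  have "refl_mat a *v a = a - (2 * c) *\<^sub>R b"
    using root_refl[OF pos_root[OF b], of a] unfolding eq c_def .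
  then have "a - (- a) = (2 * c) *\<^sub>R b" unfolding refl_mat_self
    by (metis diff_diff_eq2 diff_add_cancel add_diff_cancel_left' add.commute)
  then have "2 *\<^sub>R a = 2 *\<^sub>R (c *\<^sub>R b)" by (simp only: scaleR_2 diff_minus_eq_add scaleR_scaleR)
  then have c: "a = c *\<^sub>R b" by (simp only: scaleR_cancel_left) simp
  then have "norm a = \<bar>c\<bar> * norm b" by simp
  then have "c = 1 \<or> c = - 1" using pos_root[OF a] pos_root[OF b] by (auto simp: roots_eq)
  then have "a = b \<or> a = - b" using c by auto
  then show ?thesis using a b uminus_not_pos by auto
qed

lemma root_of_refl_mat: "a \<in> \<Phi> \<Longrightarrow> root_of R us (refl_mat a) = a"
  unfolding root_of_def using refl_mat_inj by (intro the_equality) auto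

lemma reflections_eq: "reflections R = refl_mat ` \<Phi>"
proof (intro equalityI subsetI)
  fix t assume "t \<in> reflections R"
  then obtain a where a: "a \<noteq> 0" "t = refl_mat a" "t \<in> R" by (auto simp: reflections_def)
  define b where "b = (1 / norm a) *\<^sub>R a"
  have b: "refl_mat b = t" "b \<in> roots R"
    using a by (auto simp: b_def roots_eq refl_mat_scaleR)
  then show "t \<in> refl_mat ` \<Phi>"
  proof (cases rule: root_cases[OF b(2)])
    case 1
    then show ?thesis using b(1) by blast
  next
    case 2
    then show ?thesis using b(1) by (intro image_eqI[of _ _ "- b"]) simp_all
  qed
qed (auto intro: refl_mat_root pos_root)

text \<open>As \<open>I\<close> contains only simple reflections, both intersections become sign
  conditions indexed by \<open>\<Delta>\<close>.\<close>

lemma face_eq: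
  assumes "I \<subseteq> simple_reflections \<Delta>"
  shows "face R us \<Delta> I = {x. \<forall>a\<in>\<Delta>. if refl_mat a \<in> I then x \<bullet> a = 0 else x \<bullet> a > 0}"
proof -
  have "x \<in> face R us \<Delta> I \<longleftrightarrow> (\<forall>s\<in>simple_reflections \<Delta>.
      if s \<in> I then x \<bullet> root_of R us s = 0 else x \<bullet> root_of R us s > 0)" for x
    unfolding face_def hyperplane_def pos_side_def using assms by fastforce
  then have "x \<in> face R us \<Delta> I \<longleftrightarrow> (\<forall>a\<in>\<Delta>.
      if refl_mat a \<in> I then x \<bullet> root_of R us (refl_mat a) = 0
      else x \<bullet> root_of R us (refl_mat a) > 0)" for x
    unfolding simple_reflections_def ball_simps by blast
  moreover have "(\<forall>a\<in>\<Delta>.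
      if refl_mat a \<in> I then x \<bullet> root_of R us (refl_mat a) = 0
      else x \<bullet> root_of R us (refl_mat a) > 0) \<longleftrightarrow> (\<forall>a\<in>\<Delta>. if refl_mat a \<in> I then x \<bullet> a = 0 else x \<bullet> a > 0)" for x
    by (rule ball_cong) (simp_all add: root_of_refl_mat simple_pos)
  ultimately show ?thesis by blast
qed

end

section \<open>The vertices of the bigraph as points of orbits\<close>

locale left_reflection_system = reflection_system R us \<Delta>
  for R :: "(real^'n^'n) set" and us \<Delta> +
  fixes k :: nat and S :: "nat \<Rightarrow> (real^'n^'n) set"
  assumes S: "i \<le> k \<Longrightarrow> S i \<subseteq> simple_reflections \<Delta>"
begin

text \<open>A concrete point of \<open>C(S i)\<close>; it exists because independence of
  \<open>\<Delta>\<close> allows arbitrary inner products with the simple roots.\<close>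

definition pt :: "nat \<Rightarrow> real^'n" where
  "pt i = (SOME x. \<forall>a\<in>\<Delta>. x \<bullet> a = (if refl_mat a \<in> S i then 0 else 1))"

lemma pt_simple: "a \<in> \<Delta> \<Longrightarrow> pt i \<bullet> a = (if refl_mat a \<in> S i then 0 else 1)"
  using someI_ex[OF ex_inner_simple[of "\<lambda>a. if refl_mat a \<in> S i then 0 else 1"]]
  unfolding pt_def by blast

lemma dominant_pt: "dominant (pt i)"
  by (simp add: dominant_def pt_simple)

lemma pt_face: "i \<le> k \<Longrightarrow> pt i \<in> face R us \<Delta> (S i)"
  by (simp add: face_eq S pt_simple)

abbreviation "H i \<equiv> generate GL (S i)"

lemma H_eq:
  assumes "i \<le> k"
  shows "H i = generate GL (refl_mat ` {a \<in> \<Delta>. pt i \<bullet> a = 0})"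
proof -
  have "S i = refl_mat ` {a \<in> \<Delta>. pt i \<bullet> a = 0}"
    using S[OF assms] by (auto simp: pt_simple simple_reflections_def split: if_splits)
  then show ?thesis by simp
qed

lemma H_fixes:
  assumes "i \<le> k" "h \<in> H i"
  shows "h *v pt i = pt i"
proof -
  obtain as where as: "as \<in> lists {a \<in> \<Delta>. pt i \<bullet> a = 0}" "h = wprod as"
    using assms by (auto simp: H_eq generate_refl_mat)
  have "wprod as *v pt i = pt i"
    using as(1) by (induction as) (auto simp: root_refl simple_root simp flip: matrix_vector_mul_assoc)
  then show ?thesis using as(2) by simp
qed

lemma H_subgroup:
  assumes "i \<le> k"
  shows "subgroup (H i) GL"
proof (rule group.generate_is_subgroup[OF group_GL])
  have "simple_reflections \<Delta> \<subseteq> carrier GL"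
    by (auto simp: simple_reflections_def GL_def invertible_refl_mat)
  then show "S i \<subseteq> carrier GL" using S[OF assms] by (rule order_trans[rotated])
qed

text \<open>The subgroup \<open>H i\<close> is the full stabilizer of \<open>pt i\<close>: its
  generators fix the point, and conversely \<open>dominant_unique\<close> applies to the quotient
  \<open>transpose r ** r'\<close>.\<close>

lemma coset_eq_iff:
  assumes i: "i \<le> k" and r: "r \<in> R" and r': "r' \<in> R"
  shows "r <#\<^bsub>GL\<^esub> H i = r' <#\<^bsub>GL\<^esub> H i \<longleftrightarrow> r *v pt i = r' *v pt i"
proof
  assume "r <#\<^bsub>GL\<^esub> H i = r' <#\<^bsub>GL\<^esub> H i"
  moreover have "r \<in> r <#\<^bsub>GL\<^esub> H i"
    using subgroup.one_closed[OF H_subgroup[OF i]] by (force simp: l_coset_def GL_def)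
  ultimately obtain h where "h \<in> H i" "r = r' ** h" by (auto simp: l_coset_def GL_def)
  then show "r *v pt i = r' *v pt i"
    using H_fixes[OF i] by (simp flip: matrix_vector_mul_assoc)
next
  assume eq: "r *v pt i = r' *v pt i"
  define w where "w = transpose r ** r'"
  have "w *v pt i = transpose r *v (r *v pt i)"
    unfolding w_def eq by (simp only: matrix_vector_mul_assoc)
  then have w: "w \<in> R" "w *v pt i = pt i"
    using r r' transpose_mult_vector[OF r] by (simp_all only: w_def mult_closed transpose_closed)
  then have wH: "w \<in> H i" using dominant_unique[OF w(1) dominant_pt[of i]] dominant_pt i by (simp add: H_eq)
  then have "w <#\<^bsub>GL\<^esub> H i = H i"
    using H_subgroup[OF i] by (intro group.coset_join3[OF group_GL]) (auto dest: subgroup.mem_carrier)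
  moreover have "r' = r ** w" using r by (simp add: w_def matrix_mul_assoc mult_transpose)
  ultimately show "r <#\<^bsub>GL\<^esub> H i = r' <#\<^bsub>GL\<^esub> H i" by (metis refl_map_coset)
qed

text \<open>Index \<open>0\<close> gives the vertices \<open>rR\<^sub>0\<close> of the first class, a positive index \<open>i\<close> the
  vertices \<open>(rR\<^sub>i, i)\<close> of the second one.\<close>

definition vx :: "real^'n^'n \<Rightarrow> nat \<Rightarrow> 'n refl_vertex" where
  "vx r i = (if i = 0 then Inl (r <#\<^bsub>GL\<^esub> H 0) else Inr (r <#\<^bsub>GL\<^esub> H i, i))"

abbreviation "G \<equiv> left_reflection_bigraph R k S"

lemma V1_G: "V1 G = {vx r 0 | r. r \<in> R}"
  by (simp add: left_reflection_bigraph_def vx_def)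

lemma V2_G: "V2 G = {vx r i | r i. r \<in> R \<and> 1 \<le> i \<and> i \<le> k}"
  unfolding left_reflection_bigraph_def bigraph.simps
  by (rule Collect_cong, intro ex_cong1) (auto simp: vx_def)

lemma verts_G: "verts G = {vx r i | r i. r \<in> R \<and> i \<le> k}"
proof (intro equalityI subsetI)
  fix v assume "v \<in> {vx r i | r i. r \<in> R \<and> i \<le> k}"
  then obtain r i where "v = vx r i" "r \<in> R" "i \<le> k" by blast
  then show "v \<in> verts G" unfolding verts_def V1_G V2_G by (cases "i = 0") (auto simp: Suc_le_eq)
qed (auto simp: verts_def V1_G V2_G)

lemma edges_G: "edges G = {(vx r 0, vx r i) | r i. r \<in> R \<and> 1 \<le> i \<and> i \<le> k}"
  unfolding left_reflection_bigraph_def bigraph.simps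
  by (rule Collect_cong, intro ex_cong1) (auto simp: vx_def)

lemma refl_map_vx: "refl_map t (vx r i) = vx (t ** r) i"
  by (simp add: refl_map_def vx_def refl_map_coset)

lemma vx_eq_iff:
  "i \<le> k \<Longrightarrow> r \<in> R \<Longrightarrow> r' \<in> R \<Longrightarrow> vx r i = vx r' j \<longleftrightarrow> i = j \<and> r *v pt i = r' *v pt i"
  using coset_eq_iff[of i r r'] by (auto simp: vx_def split: if_splits)

text \<open>By \<open>vx_eq_iff\<close> the point does not depend on the coset
  representative.\<close>

definition vpt :: "'n refl_vertex \<Rightarrow> real^'n" where
  "vpt v = (THE y. \<exists>r\<in>R. \<exists>i\<le>k. v = vx r i \<and> y = r *v pt i)"

lemma vpt_vx: "i \<le> k \<Longrightarrow> r \<in> R \<Longrightarrow> vpt (vx r i) = r *v pt i"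
  unfolding vpt_def by (rule the_equality) (auto simp: vx_eq_iff)

text \<open>One point decides for the whole face. Pulled back by \<open>r\<close>, the root
  \<open>a\<close> becomes a root \<open>b\<close>, which positivity at \<open>pt i\<close> forces
  to be positive. Its product with any point of the face is positive as soon as its expansion
  involves a simple root whose reflection is outside \<open>S i\<close>.\<close>

lemma image_face_subset_iff:
  assumes i: "i \<le> k" and r: "r \<in> R" and a: "a \<in> \<Phi>"
  shows "(*v) r ` face R us \<Delta> (S i) \<subseteq> pos_side a \<longleftrightarrow> (r *v pt i) \<bullet> a > 0"
proof
  assume "(*v) r ` face R us \<Delta> (S i) \<subseteq> pos_side a"
  then show "(r *v pt i) \<bullet> a > 0" using pt_face[OF i] by (auto simp: pos_side_def)
next
  assume pos: "(r *v pt i) \<bullet> a > 0"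
  define b where "b = transpose r *v a"
  have rb: "(r *v y) \<bullet> a = y \<bullet> b" for y by (simp add: b_def inner_transpose)
  have "b \<in> roots R" unfolding b_def by (intro root_image transpose_closed pos_root a r)
  then have "b \<in> \<Phi>"
  proof (cases rule: root_cases)
    case 2
    then show ?thesis using dominant_pos[OF dominant_pt[of i] 2] pos rb by simp
  qed
  then obtain c where c: "\<And>a. a \<in> \<Delta> \<Longrightarrow> c a \<ge> 0" "b = (\<Sum>a\<in>\<Delta>. c a *\<^sub>R a)"
    using pos_comb by blast
  have inner: "y \<bullet> b = (\<Sum>a\<in>\<Delta>. c a * (y \<bullet> a))" for y by (simp add: c(2) inner_sum_right)
  have "(\<Sum>a\<in>\<Delta>. c a * (pt i \<bullet> a)) \<noteq> 0"
    unfolding inner[symmetric] rb[symmetric] using pos by simp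
  moreover have "(\<Sum>a\<in>\<Delta>. c a * (pt i \<bullet> a)) = 0" if "\<forall>d\<in>\<Delta>. c d * (pt i \<bullet> d) = 0"
    by (rule sum.neutral) (rule that)
  \<comment> \<open>This \<open>d\<close> is such a simple root: its coefficient is nonzero and it
    does not vanish at \<open>pt i\<close>.\<close>
  ultimately obtain d where d: "d \<in> \<Delta>" "c d * (pt i \<bullet> d) \<noteq> 0" by blast
  show "(*v) r ` face R us \<Delta> (S i) \<subseteq> pos_side a"
  proof safe
    fix y assume "y \<in> face R us \<Delta> (S i)"
    then have y: "if refl_mat e \<in> S i then y \<bullet> e = 0 else y \<bullet> e > 0" if "e \<in> \<Delta>" for e
      using that S[OF i] by (simp add: face_eq)
    have "(\<Sum>a\<in>\<Delta>. c a * (y \<bullet> a)) > 0"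
    proof (rule sum_pos2[OF finite_simple d(1)])
      show "c d * (y \<bullet> d) > 0"
        using d y[OF d(1)] c(1)[OF d(1)] by (auto simp: pt_simple split: if_splits)
      show "c e * (y \<bullet> e) \<ge> 0" if "e \<in> \<Delta>" for e
        using y[OF that] c(1)[OF that] by (auto split: if_splits)
    qed
    then show "r *v y \<in> pos_side a" by (simp add: pos_side_def rb inner)
  qed
qed

text \<open>This brings the left side into the form required by \<open>foldI\<close>, with
  \<open>vpt v \<bullet> a\<close> as the sign function.\<close>

lemma refl_left_eq:
  assumes "a \<in> \<Phi>"
  shows "refl_left R us \<Delta> k S (refl_mat a) = {v \<in> verts G. vpt v \<bullet> a > 0}"
proof -
  have "refl_left R us \<Delta> k S (refl_mat a) = {vx r i | r i. r \<in> R \<and> i \<le> k \<and> (r *v pt i) \<bullet> a > 0}"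
    (is "?L = ?P")
  proof (intro equalityI subsetI)
    fix v assume "v \<in> ?L"
    then obtain r i where v: "v = vx r i" "r \<in> R" "i \<le> k"
      "(*v) r ` face R us \<Delta> (S i) \<subseteq> pos_side a"
      unfolding refl_left_def root_of_refl_mat[OF assms] 
    proof safe
      fix r assume *: "r \<in> R" "(*v) r ` face R us \<Delta> (S 0) \<subseteq> pos_side a"
        "\<And>r' i. Inl (r <#\<^bsub>GL\<^esub> H 0) = vx r' i \<Longrightarrow> r' \<in> R \<Longrightarrow> i \<le> k \<Longrightarrow>
          (*v) r' ` face R us \<Delta> (S i) \<subseteq> pos_side a \<Longrightarrow> thesis"
      show thesis by (rule *(3)[of r 0]) (simp_all add: vx_def * )
    next
      fix r i assume *: "r \<in> R" "1 \<le> i" "i \<le> k" "(*v) r ` face R us \<Delta> (S i) \<subseteq> pos_side a"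
        "\<And>r' j. Inr (r <#\<^bsub>GL\<^esub> H i, i) = vx r' j \<Longrightarrow> r' \<in> R \<Longrightarrow> j \<le> k \<Longrightarrow>
          (*v) r' ` face R us \<Delta> (S j) \<subseteq> pos_side a \<Longrightarrow> thesis"
      show thesis by (rule *(5)[of r i]) (use *(1-4) in \<open>simp_all add: vx_def\<close>)
    qed
    then show "v \<in> ?P" using image_face_subset_iff[OF _ _ assms] by blast
  next
    fix v assume "v \<in> ?P"
    then obtain r i where v: "v = vx r i" "r \<in> R" "i \<le> k" "(r *v pt i) \<bullet> a > 0" by blast
    then have "(*v) r ` face R us \<Delta> (S i) \<subseteq> pos_side a" using image_face_subset_iff assms by blast
    then show "v \<in> ?L"
      unfolding refl_left_def root_of_refl_mat[OF assms] using v
      by (cases "i = 0") (auto simp: vx_def)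
  qed
  also have "\<dots> = {v \<in> verts G. vpt v \<bullet> a > 0}"
  proof (intro equalityI subsetI)
    fix v assume "v \<in> {v \<in> verts G. vpt v \<bullet> a > 0}"
    then obtain r i where v: "v = vx r i" "r \<in> R" "i \<le> k" "vpt v \<bullet> a > 0" by (auto simp: verts_G)
    then have "(r *v pt i) \<bullet> a > 0" by (simp add: vpt_vx)
    then show "v \<in> ?P" using v by blast
  qed (auto simp: verts_G vpt_vx)
  finally show ?thesis .
qed

lemma vpt_refl_map:
  assumes "a \<in> \<Phi>" "v \<in> verts G"
  shows "vpt (refl_map (refl_mat a) v) = refl_mat a *v vpt v"
  using assms
  by (auto simp: verts_G refl_map_vx vpt_vx mult_closed refl_closed pos_root matrix_vector_mul_assoc)

text \<open>The vertex \<open>w\<close> off the hyperplane of \<open>a\<close> guarantees that the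
  reflection moves something, as disconnectedness requires.\<close>

lemma reflection_fold:
  assumes a: "a \<in> \<Phi>" and w: "w \<in> verts G" "vpt w \<bullet> a \<noteq> 0"
  shows "(refl_map (refl_mat a), refl_left R us \<Delta> k S (refl_mat a)) \<in> reflection_folds R us \<Delta> k S"
proof -
  note aR = refl_closed[OF pos_root[OF a]]
  have "(refl_map (refl_mat a), {v \<in> verts G. vpt v \<bullet> a > 0}) \<in> folds G"
  proof (rule foldI[where w = w])
    show "edges G \<subseteq> V1 G \<times> V2 G" unfolding edges_G V1_G V2_G by blast
    show "refl_map (refl_mat a) v \<in> V1 G" if "v \<in> V1 G" for v
      using that aR unfolding V1_G by (auto simp: refl_map_vx mult_closed)
    show "refl_map (refl_mat a) v \<in> V2 G" if v: "v \<in> V2 G" for v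
    proof -
      obtain r i where "v = vx r i" "r \<in> R" "1 \<le> i" "i \<le> k" using v unfolding V2_G by blast
      then show ?thesis unfolding V2_G using mult_closed[OF aR] refl_map_vx by blast
    qed
    show "refl_map (refl_mat a) (refl_map (refl_mat a) v) = v" if "v \<in> verts G" for v
      using that unfolding verts_G by (auto simp: refl_map_vx matrix_mul_assoc)
    show "(refl_map (refl_mat a) u, refl_map (refl_mat a) v) \<in> edges G" if uv: "(u, v) \<in> edges G" for u v
    proof -
      obtain r i where "u = vx r 0" "v = vx r i" "r \<in> R" "1 \<le> i" "i \<le> k"
        using uv unfolding edges_G by blast
      then show ?thesis unfolding edges_G using mult_closed[OF aR] refl_map_vx by blast
    qed
    show "vpt (refl_map (refl_mat a) v) \<bullet> a = - (vpt v \<bullet> a)" if "v \<in> verts G" for v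
      using that a by (simp add: vpt_refl_map refl_mat_inner)
    show "refl_map (refl_mat a) v = v" if v: "v \<in> verts G" and 0: "vpt v \<bullet> a = 0" for v
    proof -
      obtain r i where ri: "v = vx r i" "r \<in> R" "i \<le> k" using v by (auto simp: verts_G)
      then have "refl_mat a *v (r *v pt i) = r *v pt i"
        using 0 a by (simp add: root_refl pos_root vpt_vx)
      then show ?thesis using ri aR
        by (simp add: refl_map_vx vx_eq_iff mult_closed flip: matrix_vector_mul_assoc)
    qed
    show "(vpt u \<bullet> a) * (vpt v \<bullet> a) \<ge> 0" if uv: "(u, v) \<in> edges G" for u v
    proof -
      obtain r i where ri: "u = vx r 0" "v = vx r i" "r \<in> R" "i \<le> k" using uv by (auto simp: edges_G)
      \<comment> \<open>Both ends of an edge are images of dominant points under the same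
        \<open>r\<close>; pulling \<open>a\<close> back by \<open>r\<close> reduces the claim to a
        root having one weak sign on the closed chamber.\<close>
      define b where "b = transpose r *v a"
      have b: "vpt u \<bullet> a = pt 0 \<bullet> b" "vpt v \<bullet> a = pt i \<bullet> b"
        using ri by (simp_all add: b_def vpt_vx inner_transpose)
      have "b \<in> roots R" unfolding b_def by (intro root_image transpose_closed pos_root a ri)
      then show ?thesis
      proof (cases rule: root_cases)
        case 1
        then show ?thesis using dominant_pos[OF dominant_pt 1] by (simp add: b)
      next
        case 2
        then show ?thesis using dominant_pos[OF dominant_pt 2] by (simp add: b mult_nonpos_nonpos)
      qed
    qed
  qed (use w in simp_all)
  then show ?thesis
    unfolding reflection_folds_def refl_left_eq[OF a, symmetric] using a reflections_eq by blast
qed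

text \<open>The potential \<open>\<rho> \<bullet> vpt v\<close> rises whenever a fold moves
  \<open>v\<close>: reflection changes it by
  \<open>- 2 * ((vpt v \<bullet> a) * (\<rho> \<bullet> a))\<close>, where
  \<open>\<rho> \<bullet> a\<close> is positive and a moved point lies on the negative side of
  \<open>a\<close>.\<close>

lemma left_reflection_percolating: "left_cut_percolating G (reflection_folds R us \<Delta> k S)"
proof (rule left_cut_percolatingI[where h = "\<lambda>v. \<rho> \<bullet> vpt v" and ?v0.0 = "vx (mat 1) 0"])
  show "wf_bigraph G"
    using reflection_group by (intro wf_left_reflection_bigraph) (simp add: finite_reflection_group_def)
  show "reflection_folds R us \<Delta> k S \<subseteq> folds G" by (auto simp: reflection_folds_def)
  show "vx (mat 1) 0 \<in> V1 G" using one_closed unfolding V1_G by blast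
next
  fix \<phi> L v assume fold: "(\<phi>, L) \<in> reflection_folds R us \<Delta> k S" and "v \<in> V1 G"
  then have v: "v \<in> verts G" by (simp add: verts_def)
  obtain a where a: "a \<in> \<Phi>" "\<phi> = refl_map (refl_mat a)" "L = refl_left R us \<Delta> k S (refl_mat a)"
    using fold by (auto simp: reflection_folds_def reflections_eq)
  show "left_folding \<phi> L v = v \<or> \<rho> \<bullet> vpt v < \<rho> \<bullet> vpt (left_folding \<phi> L v)"
  proof (cases "vpt v \<bullet> a" "0 :: real" rule: linorder_cases)
    case less
    then have fold_v: "left_folding \<phi> L v = refl_map (refl_mat a) v"
      by (simp add: left_folding_def a(2,3) refl_left_eq[OF a(1)])
    have "(vpt v \<bullet> a) * (\<rho> \<bullet> a) < 0" using less rho_pos[OF a(1)] by (simp add: mult_neg_pos)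
    moreover have "\<rho> \<bullet> (refl_mat a *v vpt v) = \<rho> \<bullet> vpt v - 2 * ((vpt v \<bullet> a) * (\<rho> \<bullet> a))"
      by (simp add: root_refl[OF pos_root[OF a(1)]] inner_diff_right)
    ultimately have "\<rho> \<bullet> vpt v < \<rho> \<bullet> (refl_mat a *v vpt v)" by linarith
    then show ?thesis unfolding fold_v vpt_refl_map[OF a(1) v] ..
  next
    case equal
    obtain r i where ri: "v = vx r i" "r \<in> R" "i \<le> k" using v by (auto simp: verts_G)
    then have "refl_mat a *v (r *v pt i) = r *v pt i"
      using equal a by (simp add: root_refl pos_root vpt_vx)
    then have "refl_map (refl_mat a) v = v" using ri refl_closed[OF pos_root[OF a(1)]]
      by (simp add: refl_map_vx vx_eq_iff mult_closed flip: matrix_vector_mul_assoc)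
    then show ?thesis by (simp add: left_folding_def a(2))
  next
    case greater
    then show ?thesis using v by (simp add: left_folding_def a(3) refl_left_eq[OF a(1)])
  qed
next
  fix v assume "v \<in> V1 G" and ne: "v \<noteq> vx (mat 1) 0"
  then obtain r where r: "v = vx r 0" "r \<in> R" and v: "v \<in> verts G" by (auto simp: V1_G verts_def)
  \<comment> \<open>Only the base coset has a dominant point, so some simple root is negative at
    \<open>v\<close> and its fold moves \<open>v\<close>.\<close>
  have "\<not> dominant (r *v pt 0)"
  proof
    assume "dominant (r *v pt 0)"
    then have "r \<in> H 0" using dominant_unique[OF r(2) dominant_pt[of 0]] by (simp add: H_eq)
    then have "r *v pt 0 = pt 0" by (simp add: H_fixes)
    then show False using ne r one_closed by (simp add: vx_eq_iff)
  qed
  then obtain a where a: "a \<in> \<Delta>" "vpt v \<bullet> a < 0"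
    using r by (auto simp: dominant_def not_le vpt_vx)
  let ?\<phi> = "refl_map (refl_mat a)" and ?L = "refl_left R us \<Delta> k S (refl_mat a)"
  have aP: "a \<in> \<Phi>" by (rule simple_pos[OF a(1)])
  have "(?\<phi>, ?L) \<in> reflection_folds R us \<Delta> k S"
    using a v by (intro reflection_fold[OF aP]) auto
  moreover have "left_folding ?\<phi> ?L v \<noteq> v"
  proof
    assume "left_folding ?\<phi> ?L v = v"
    \<comment> \<open>The negative product puts \<open>v\<close> outside \<open>?L\<close>, where
      left-folding acts as \<open>?\<phi>\<close>.\<close>
    then have "vpt (?\<phi> v) = vpt v" using a(2) by (simp add: left_folding_def refl_left_eq[OF aP])
    then have "refl_mat a *v vpt v = vpt v" using vpt_refl_map[OF aP v] by simp
    then have "(refl_mat a *v vpt v) \<bullet> a = vpt v \<bullet> a" by simp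
    then show False using a(2) by (simp add: refl_mat_inner)
  qed
  ultimately show "\<exists>(\<phi>, L)\<in>reflection_folds R us \<Delta> k S. left_folding \<phi> L v \<noteq> v" by blast
qed

end

theorem theorem3p1:
  fixes R :: "(real^'n^'n) set" and us :: "(real^'n) list" and \<Delta> :: "(real^'n) set"
    and k :: nat and S :: "nat \<Rightarrow> (real^'n^'n) set"
  assumes "finite_reflection_group R"
    and "ordered_basis us"
    and "simple_system R us \<Delta>"
    and "k \<ge> 1"
    and "\<And>i. i \<le> k \<Longrightarrow> S i \<subseteq> simple_reflections \<Delta>"
  shows "left_cut_percolating (left_reflection_bigraph R k S) (reflection_folds R us \<Delta> k S)"
proof -
  interpret left_reflection_system R us \<Delta> k S
    by unfold_locales (use assms in auto)
  show ?thesis by (rule left_reflection_percolating)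
qed

end
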